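(* Let $n\ge4$, let $\mathcal{G}\subseteq\mathrm{GL}_n(\mathbb{Z})$ be the integer representation of the Weyl group of type $\mathrm{D}_n$ with respect to the fundamental weights, and let $\mathcal{T}$ be its $\mathbb{T}$-orbit space. Let $\mathcal{Z}=\mathbb{R}^n$ if $n$ is even and $\mathcal{Z}=\{z\in\mathbb{C}^n\mid z_1,\dots,z_{n-2}\in\mathbb{R},\ \overline{z_n}=z_{n-1}\}$ if $n$ is odd (an $n$-dimensional real vector space). In $\mathbb{Q}[z_1,\dots,z_n]$ put $c_i(z)=(-1)^i\binom niz_i$ for $1\le i\le n-2$, \[ c_{n-1}(z)=(-1)^{n-1}\begin{cases}2^{n-1}z_nz_{n-1}-\sum_{j=1}^{(n-2)/2}\binom n{2j-1}z_{2j-1},&n\text{ even},\\[2pt]2^{n-1}z_nz_{n-1}-\sum_{j=1}^{(n-3)/2}\binom n{2j}z_{2j}-1,&n\text{ odd},\end{cases} \] \[ c_n(z)=(-1)^n\begin{cases}2^{n-2}(z_n^2+z_{n-1}^2)-\sum_{j=1}^{(n-2)/2}\binom n{2j}z_{2j}-1,&n\text{ even},\\[2pt]2^{n-2}(z_n^2+z_{n-1}^2)-\sum_{j=0}^{(n-3)/2}\binom n{2j+1}z_{2j+1},&n\text{ odd}.\end{cases} \] Let \[ C(z)=\begin{bmatrix}0&\cdots&0&-c_n(z)\\1&&0&-c_{n-1}(z)\\&\ddots&&\vdots\\0&&1&-c_1(z)\end{bmatrix}\in\mathbb{Q}[z]^{n\times n} \] be the companion matrix, and define $H\in\mathbb{Q}[z]^{n\times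 n}$ by $H(z)_{ij}=\mathrm{Tr}\big(C(z)^{i+j-2}-C(z)^{i+j}\big)$. Then $H(z)\in\mathbb{R}^{n\times n}$ for all $z\in\mathcal{Z}$, and \[ \mathcal{T}=\{z\in\mathcal{Z}\mid H(z)\succeq0\}. \]
   Context: $\mathbb{T}=\{x\in\mathbb{C}\mid|x|=1\}$; $\succeq0$ means positive semidefinite. The matrix $C(z)$ has ones on the first subdiagonal, last column $(-c_n,-c_{n-1},\dots,-c_1)^t$, and zeros elsewhere. The Weyl group $\mathcal{W}\cong\mathfrak{S}_n\ltimes\{\pm1\}^n_+$ of $\mathrm{D}_n$ acts on $\mathbb{R}^n$ by signed permutations of coordinates with an even number of sign changes; the fundamental weights are $\omega_i=\epsilon_1+\dots+\epsilon_i$ for $1\le i\le n-2$, $\omega_{n-1}=(\epsilon_1+\dots+\epsilon_{n-1}-\epsilon_n)/2$ and $\omega_n=(\epsilon_1+\dots+\epsilon_n)/2$ ($\epsilon_j$ standard basis vectors of $\mathbb{R}^n$). The integer representation $\mathcal{G}$ is the group of matrices of elements of $\mathcal{W}$ in the basis $\omega_1,\dots,\omega_n$. For $x\in(\mathbb{C}^* )^n$, $\alpha\in\mathbb{Z}^n$, $x^\alpha=\prod x_i^{\alpha_i}$; $\theta_i(x)=\frac1{|\mathcal{G}|}\sum_{B\in\mathcal{G}}x^{Be_i}$ ($e_i$ standard basis of $\mathbb{Z}^n$). The $\mathbb{T}$-orbit space is $\mathcal{T}=\{(\theta_1(x),\dots,\theta_n(x))\mid x\in\mathbb{T}^n\}\subseteq\mathbb{C}^n$.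 *)

theory Defs
  imports Complex_Main "HOL-Combinatorics.Permutations" "Jordan_Normal_Form.Matrix"
begin

text \<open>
  Vectors and matrices are indexed from 0 in the library, while \<open>z\<^sub>1, \<dots>, z\<^sub>n\<close>, the weights and
  the coefficients \<open>c\<^sub>1, \<dots>, c\<^sub>n\<close> are numbered from 1; \<open>z $\<^sub>1 i\<close> is the \<open>i\<close>-th entry counted from 1.
\<close>

abbreviation vec_entry1 :: "'a vec \<Rightarrow> nat \<Rightarrow> 'a" (infixl \<open>$\<^sub>1\<close> 100)
  where "z $\<^sub>1 i \<equiv> z $ (i - 1)"

section \<open>The Weyl group of type D and its integer representation\<close>

text \<open>
  The element given by \<open>\<pi>\<close> and \<open>S\<close> sends \<open>\<epsilon>\<^sub>j\<close> to \<open>-\<epsilon>\<^bsub>\<pi> j\<^esub>\<close> if \<open>j \<in> S\<close> and to \<open>\<epsilon>\<^bsub>\<pi> j\<^esub>\<close> otherwise.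
\<close>

definition signed_perm_mat :: "nat \<Rightarrow> (nat \<Rightarrow> nat) \<Rightarrow> nat set \<Rightarrow> real mat"
  where "signed_perm_mat n \<pi> S =
    mat n n (\<lambda>(i, j). if i = \<pi> j then (if j \<in> S then - 1 else 1) else 0)"

definition weyl_group_D :: "nat \<Rightarrow> real mat set"
  where "weyl_group_D n =
    {signed_perm_mat n \<pi> S | \<pi> S. \<pi> permutes {..<n} \<and> S \<subseteq> {..<n} \<and> even (card S)}"

definition fund_weight_D :: "nat \<Rightarrow> nat \<Rightarrow> real vec"
  where "fund_weight_D n i = vec n (\<lambda>j.
    if i \<le> n - 2 then (if j < i then 1 else 0)
    else if i = n - 1 then (if j < n - 1 then 1 / 2 else - 1 / 2)
    else 1 / 2)"

definition weight_mat_D :: "nat \<Rightarrow> real mat"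
  where "weight_mat_D n = mat_of_cols n (map (fund_weight_D n) [1..<n + 1])"

text \<open>
  With \<open>\<Omega>\<close> the matrix whose columns are the fundamental weights, \<open>w * \<Omega> = \<Omega> * B\<close> says that
  \<open>w \<omega>\<^sub>j = (\<Sum>i. B\<^sub>i\<^sub>j \<omega>\<^sub>i)\<close>, i.e. that \<open>B\<close> is the matrix of \<open>w\<close> in the basis of fundamental weights.
  The Weyl group preserves the weight lattice, so every \<open>w\<close> does have such an integer matrix.
\<close>

definition integer_rep_D :: "nat \<Rightarrow> int mat set"
  where "integer_rep_D n = {B \<in> carrier_mat n n.
    \<exists>w \<in> weyl_group_D n. w * weight_mat_D n = weight_mat_D n * map_mat real_of_int B}"

section \<open>Orbit space\<close>

definition laurent_monom :: "complex vec \<Rightarrow> int vec \<Rightarrow> complex"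
  where "laurent_monom x \<alpha> = (\<Prod>i<dim_vec x. (x $ i) powi (\<alpha> $ i))"

definition orbit_poly_D :: "nat \<Rightarrow> nat \<Rightarrow> complex vec \<Rightarrow> complex"
  where "orbit_poly_D n i x =
    1 / of_nat (card (integer_rep_D n)) *
    (\<Sum>B \<in> integer_rep_D n. laurent_monom x (B *\<^sub>v unit_vec n (i - 1)))"

definition compact_torus :: "nat \<Rightarrow> complex vec set"
  where "compact_torus n = {x \<in> carrier_vec n. \<forall>i<n. cmod (x $ i) = 1}"

definition torus_orbit_space_D :: "nat \<Rightarrow> complex vec set"
  where "torus_orbit_space_D n =
    (\<lambda>x. vec n (\<lambda>k. orbit_poly_D n (k + 1) x)) ` compact_torus n"

definition ambient_D :: "nat \<Rightarrow> complex vec set"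
  where "ambient_D n = (if even n
    then {z \<in> carrier_vec n. \<forall>i \<in> {1..n}. z $\<^sub>1 i \<in> \<real>}
    else {z \<in> carrier_vec n. (\<forall>i \<in> {1..n - 2}. z $\<^sub>1 i \<in> \<real>) \<and> cnj (z $\<^sub>1 n) = z $\<^sub>1 (n - 1)})"

section \<open>The Hermite matrix polynomial\<close>

text \<open>
  All coefficients of the polynomials \<open>c\<^sub>i\<close> are integers, so they and the matrices built from
  them are defined over an arbitrary commutative ring, as the functions evaluating them at \<open>z\<close>.
\<close>

definition char_coeff_D :: "nat \<Rightarrow> 'a::comm_ring_1 vec \<Rightarrow> nat \<Rightarrow> 'a"
  where "char_coeff_D n z i =
    (if i \<le> n - 2 then (- 1) ^ i * of_nat (n choose i) * z $\<^sub>1 i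
     else if i = n - 1 then
       (- 1) ^ (n - 1) *
         (if even n
          then 2 ^ (n - 1) * z $\<^sub>1 n * z $\<^sub>1 (n - 1)
            - (\<Sum>j = 1..(n - 2) div 2. of_nat (n choose (2 * j - 1)) * z $\<^sub>1 (2 * j - 1))
          else 2 ^ (n - 1) * z $\<^sub>1 n * z $\<^sub>1 (n - 1)
            - (\<Sum>j = 1..(n - 3) div 2. of_nat (n choose (2 * j)) * z $\<^sub>1 (2 * j)) - 1)
     else
       (- 1) ^ n *
         (if even n
          then 2 ^ (n - 2) * ((z $\<^sub>1 n)\<^sup>2 + (z $\<^sub>1 (n - 1))\<^sup>2)
            - (\<Sum>j = 1..(n - 2) div 2. of_nat (n choose (2 * j)) * z $\<^sub>1 (2 * j)) - 1
          else 2 ^ (n - 2) * ((z $\<^sub>1 n)\<^sup>2 + (z $\<^sub>1 (n - 1))\<^sup>2)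
            - (\<Sum>j = 0..(n - 3) div 2. of_nat (n choose (2 * j + 1)) * z $\<^sub>1 (2 * j + 1))))"

definition companion_D :: "nat \<Rightarrow> 'a::comm_ring_1 vec \<Rightarrow> 'a mat"
  where "companion_D n z = mat n n (\<lambda>(i, j).
    if j = n - 1 then - char_coeff_D n z (n - i) else if i = j + 1 then 1 else 0)"

definition mat_trace :: "'a::comm_monoid_add mat \<Rightarrow> 'a"
  where "mat_trace A = (\<Sum>i<dim_row A. A $$ (i, i))"

text \<open>
  With 0-based indices the exponents \<open>i + j - 2\<close> and \<open>i + j\<close> become \<open>i + j\<close> and \<open>i + j + 2\<close>.
\<close>

definition hermite_mat_D :: "nat \<Rightarrow> 'a::comm_ring_1 vec \<Rightarrow> 'a mat"
  where "hermite_mat_D n z = mat n n (\<lambda>(i, j).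
    mat_trace (companion_D n z ^\<^sub>m (i + j) - companion_D n z ^\<^sub>m (i + j + 2)))"

definition psd_mat :: "real mat \<Rightarrow> bool"
  where "psd_mat A \<longleftrightarrow> square_mat A \<and> transpose_mat A = A \<and>
    (\<forall>v \<in> carrier_vec (dim_row A). 0 \<le> v \<bullet> (A *\<^sub>v v))"

end

theory Submission
  imports Defs "Jordan_Normal_Form.Schur_Decomposition"
begin

text \<open>
  Write a point \<open>x\<close> of the torus in terms of \<open>s\<^sub>1, \<dots>, s\<^sub>n\<close> of modulus 1, where \<open>s\<^sub>k\<^sup>2 = exp(i t\<^sub>k)\<close> are the
  coordinates belonging to \<open>\<epsilon>\<^sub>k\<close>. Averaging over the Weyl group gives \<open>binom(n, i) \<theta>\<^sub>i = e\<^sub>i(cos t\<^sub>1, \<dots>, cos t\<^sub>n)\<close>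
  for \<open>i \<le> n - 2\<close>, while \<open>2^(n-1) (\<theta>\<^sub>n \<plusminus> \<theta>\<^bsub>n-1\<^esub>)\<close> is the product of the \<open>s\<^sub>k \<plusminus> 1/s\<^sub>k\<close>. The squares of these
  two products are \<open>2^n \<Prod>(1 + cos t\<^sub>k)\<close> and \<open>(-2)^n \<Prod>(1 - cos t\<^sub>k)\<close>, so the characteristic polynomial of
  \<open>C(\<theta>(x))\<close> is \<open>\<Prod>(X - cos t\<^sub>k)\<close>.

  If \<open>r\<^sub>k\<close> are the roots of the characteristic polynomial of \<open>C(z)\<close>, then \<open>H(z)\<close> is the matrix of the quadratic
  form \<open>q \<mapsto> \<Sum>\<^sub>k (1 - r\<^sub>k\<^sup>2) q(r\<^sub>k)\<^sup>2\<close> on real polynomials \<open>q\<close> of degree less than \<open>n\<close>. It is positive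
  semidefinite iff all \<open>r\<^sub>k\<close> lie in \<open>[-1, 1]\<close>, since otherwise interpolation yields a \<open>q\<close> with a negative value.
  Finally, \<open>z\<^sub>1, \<dots>, z\<^bsub>n-2\<^esub>\<close> and \<open>(z\<^sub>n \<plusminus> z\<^bsub>n-1\<^esub>)\<^sup>2\<close> are determined by the roots, and the remaining two signs are
  adjusted by replacing \<open>s\<^sub>1\<close> with \<open>\<plusminus>s\<^sub>1\<close> or \<open>\<plusminus>1/s\<^sub>1\<close>, which does not change \<open>cos t\<^sub>1\<close>.
\<close>

section \<open>Elementary symmetric functions and averages over signed permutations\<close>

definition esym :: "nat \<Rightarrow> nat \<Rightarrow> (nat \<Rightarrow> 'a::comm_ring_1) \<Rightarrow> 'a"
  where "esym n i f = (\<Sum>A | A \<subseteq> {..<n} \<and> card A = i. \<Prod>l\<in>A. f l)"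

lemma esym_0 [simp]: "esym n 0 f = 1"
proof -
  have "{A. A \<subseteq> {..<n} \<and> card A = 0} = {{}}"
    by (auto simp: card_eq_0_iff dest: finite_subset)
  thus ?thesis by (simp only: esym_def) simp
qed

text \<open>A choice of summands in the product is a subset of the factors, and subsets of equal
  size carry the same power of \<open>b\<close>. The case \<open>b = 1\<close> gives the values of
  the characteristic polynomial at 1 and -1, up to sign.\<close>

lemma prod_add_const_esym:
  fixes f :: "nat \<Rightarrow> 'a::comm_ring_1"
  shows "(\<Prod>l<n. f l + b) = (\<Sum>i\<le>n. esym n i f * b ^ (n - i))"
proof -
  have "(\<Prod>l<n. f l + b) = (\<Sum>A\<in>Pow {..<n}. (\<Prod>l\<in>A. f l) * (\<Prod>l\<in>{..<n} - A. b))"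
    by (rule prod_add) simp
  also have "\<dots> = (\<Sum>A\<in>Pow {..<n}. (\<Prod>l\<in>A. f l) * b ^ (n - card A))"
    by (intro sum.cong refl) (simp add: card_Diff_subset finite_subset)
  also have "\<dots> = (\<Sum>i\<le>n. \<Sum>A | A \<in> Pow {..<n} \<and> card A = i. (\<Prod>l\<in>A. f l) * b ^ (n - card A))"
    using card_mono[of "{..<n}"] by (intro sum.group[symmetric]) auto
  also have "\<dots> = (\<Sum>i\<le>n. esym n i f * b ^ (n - i))"
    unfolding esym_def sum_distrib_right by (intro sum.cong refl) auto
  finally show ?thesis .
qed

lemma esym_scale: "esym n i (\<lambda>l. a * f l) = a ^ i * esym n i f"
  unfolding esym_def sum_distrib_left by (intro sum.cong) (auto simp: prod.distrib)

lemma (in comm_ring_hom) hom_esym: "hom (esym n i f) = esym n i (\<lambda>l. hom (f l))"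
  unfolding esym_def by (simp add: hom_sum hom_prod)

lemma prod_linear_esym:
  fixes f :: "nat \<Rightarrow> 'a::comm_ring_1"
  shows "(\<Prod>l<n. [:- f l, 1:]) = (\<Sum>i\<le>n. monom ((- 1) ^ i * esym n i f) (n - i))"
proof -
  \<comment> \<open>Constants embed into polynomials by a ring homomorphism, so \<open>esym\<close>
    of constant polynomials is again constant. Expanding with the indeterminate as \<open>b\<close>
    then gives Vieta's formulas.\<close>
  interpret coeff_lift_hom: comm_ring_hom "\<lambda>c::'a. [:c:]"
    by unfold_locales (auto simp: one_pCons)
  have "(\<Prod>l<n. [:- f l, 1:]) = (\<Prod>l<n. [:- 1 * f l:] + [:0, 1:])"
    by simp
  also have "\<dots> = (\<Sum>i\<le>n. [:(- 1) ^ i * esym n i f:] * [:0, 1:] ^ (n - i))"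
    unfolding prod_add_const_esym by (simp only: coeff_lift_hom.hom_esym[symmetric] esym_scale)
  finally show ?thesis by (simp add: monom_altdef smult_sum2)
qed

lemma prod_diff_const_esym:
  fixes f :: "nat \<Rightarrow> 'a::comm_ring_1"
  shows "(\<Prod>l<n. 1 - f l) = (\<Sum>i\<le>n. (- 1) ^ i * esym n i f)"
  using prod_add_const_esym[of "\<lambda>l. - 1 * f l" 1 n] unfolding esym_scale by simp

text \<open>Bijections onto \<open>A\<close> and onto its complement in \<open>{..<n}\<close> are
  glued. This moves any index set of given size to an initial segment.\<close>

lemma exists_permutation_image:
  assumes A: "A \<subseteq> {..<n}"
  shows "\<exists>\<sigma>. \<sigma> permutes {..<n} \<and> \<sigma> ` {..<card A} = A"
proof -
  have fin: "finite A" using A finite_subset by blast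
  obtain f where f: "bij_betw f {..<card A} A"
    using ex_bij_betw_nat_finite[OF fin] by (auto simp: atLeast0LessThan)
  have le: "card A \<le> n" using card_mono[OF _ A] by simp
  have "card ({..<n} - {..<card A}) = card ({..<n} - A)"
    using le A by (simp add: card_Diff_subset fin)
  then obtain g where g: "bij_betw g ({..<n} - {..<card A}) ({..<n} - A)"
    using finite_same_card_bij[of "{..<n} - {..<card A}" "{..<n} - A"] by auto
  define \<sigma> where "\<sigma> l = (if l < card A then f l else if l < n then g l else l)" for l
  have "bij_betw \<sigma> {..<card A} A"
    using f by (subst bij_betw_cong[of _ _ f]) (auto simp: \<sigma>_def)
  moreover have "bij_betw \<sigma> ({..<n} - {..<card A}) ({..<n} - A)"
    using g by (subst bij_betw_cong[of _ _ g]) (auto simp: \<sigma>_def)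
  ultimately have "bij_betw \<sigma> ({..<card A} \<union> ({..<n} - {..<card A})) (A \<union> ({..<n} - A))"
    by (rule bij_betw_combine) auto
  moreover have "{..<card A} \<union> ({..<n} - {..<card A}) = {..<n}" "A \<union> ({..<n} - A) = {..<n}"
    using le A by auto
  ultimately have "\<sigma> permutes {..<n}"
    using le by (intro bij_imp_permutes) (auto simp: \<sigma>_def)
  thus ?thesis using \<open>bij_betw \<sigma> {..<card A} A\<close> by (auto simp: bij_betw_def)
qed

text \<open>Double counting of permutations and \<open>i\<close>-subsets: for a fixed subset the sum
  over permutations depends only on its size, and for a fixed permutation the sum over subsets is
  \<open>esym n i f\<close> by symmetry.\<close>

lemma sum_permutations_prod:
  fixes f :: "nat \<Rightarrow> 'a::comm_ring_1"
  assumes "i \<le> n"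
  shows "of_nat (n choose i) * (\<Sum>\<pi> | \<pi> permutes {..<n}. \<Prod>l<i. f (\<pi> l)) = of_nat (fact n) * esym n i f"
proof -
  let ?S = "\<lambda>A. \<Sum>\<pi> | \<pi> permutes {..<n}. \<Prod>l\<in>A. f (\<pi> l)"
  have S: "?S A = ?S {..<i}" if A: "A \<subseteq> {..<n}" "card A = i" for A
  proof -
    obtain \<sigma> where \<sigma>: "\<sigma> permutes {..<n}" "\<sigma> ` {..<i} = A"
      using exists_permutation_image[OF A(1)] A(2) by auto
    have inj: "inj_on \<sigma> {..<i}" by (rule permutes_inj_on[OF \<sigma>(1)])
    have "?S A = ?S (\<sigma> ` {..<i})" by (simp add: \<sigma>(2))
    also have "\<dots> = (\<Sum>\<pi> | \<pi> permutes {..<n}. \<Prod>l<i. f ((\<pi> \<circ> \<sigma>) l))"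
      by (simp add: prod.reindex[OF inj])
    also have "\<dots> = ?S {..<i}"
      by (rule sum_permutations_compose_right[OF \<sigma>(1), symmetric])
    finally show ?thesis .
  qed
  have esym_perm: "(\<Sum>A | A \<subseteq> {..<n} \<and> card A = i. \<Prod>l\<in>A. f (\<pi> l)) = esym n i f"
    if \<pi>: "\<pi> permutes {..<n}" for \<pi>
  proof -
    have inj: "inj_on \<pi> A" for A :: "nat set" using permutes_inj_on[OF \<pi>] .
    have im: "image \<pi> ` {A. A \<subseteq> {..<n} \<and> card A = i} = {A. A \<subseteq> {..<n} \<and> card A = i}"
    proof (intro equalityI subsetI)
      fix B assume "B \<in> image \<pi> ` {A. A \<subseteq> {..<n} \<and> card A = i}"
      thus "B \<in> {A. A \<subseteq> {..<n} \<and> card A = i}"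
        using permutes_image[OF \<pi>] by (auto simp: card_image[OF inj])
    next
      fix B assume B: "B \<in> {A. A \<subseteq> {..<n} \<and> card A = i}"
      have "B = \<pi> ` (Hilbert_Choice.inv \<pi> ` B)"
        by (simp add: image_image permutes_inverses[OF \<pi>])
      moreover have "Hilbert_Choice.inv \<pi> ` B \<subseteq> {..<n}"
        using B permutes_image[OF permutes_inv[OF \<pi>]] by auto
      moreover have "card (Hilbert_Choice.inv \<pi> ` B) = i"
        using B by (simp add: card_image[OF permutes_inj_on[OF permutes_inv[OF \<pi>]]])
      ultimately show "B \<in> image \<pi> ` {A. A \<subseteq> {..<n} \<and> card A = i}" by blast
    qed
    have "inj_on (image \<pi>) {A. A \<subseteq> {..<n} \<and> card A = i}"
      by (intro inj_onI) (metis inj_image_eq_iff permutes_inj[OF \<pi>])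
    hence "esym n i f = (\<Sum>A | A \<subseteq> {..<n} \<and> card A = i. \<Prod>l\<in>\<pi> ` A. f l)"
      unfolding esym_def by (subst im[symmetric], subst sum.reindex) auto
    thus ?thesis by (simp add: prod.reindex[OF inj])
  qed
  have "of_nat (n choose i) * ?S {..<i} = (\<Sum>A | A \<subseteq> {..<n} \<and> card A = i. ?S A)"
    by (simp add: S n_subsets)
  also have "\<dots> = (\<Sum>\<pi> | \<pi> permutes {..<n}. \<Sum>A | A \<subseteq> {..<n} \<and> card A = i. \<Prod>l\<in>A. f (\<pi> l))"
    by (rule sum.swap)
  also have "\<dots> = of_nat (fact n) * esym n i f"
    by (simp add: esym_perm card_permutations[of _ n])
  finally show ?thesis .
qed

section \<open>Sums over an even number of sign changes\<close>

abbreviation even_subsets :: "nat \<Rightarrow> nat set set"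
  where "even_subsets n \<equiv> {S. S \<subseteq> {..<n} \<and> even (card S)}"

text \<open>Adding the expansion with \<open>f\<close> to the one with \<open>- f\<close> cancels
  the subsets of odd size and doubles the even ones.\<close>

lemma sum_even_subsets:
  fixes f g :: "nat \<Rightarrow> 'a::comm_ring_1"
  shows "2 * (\<Sum>S\<in>even_subsets n. \<Prod>l<n. if l \<in> S then f l else g l)
    = (\<Prod>l<n. g l + f l) + (\<Prod>l<n. g l - f l)"
proof -
  have *: "(\<Prod>l<n. if l \<in> S then h l else g l) = (\<Prod>l\<in>S. h l) * (\<Prod>l\<in>{..<n} - S. g l)"
    if "S \<in> Pow {..<n}" for S and h :: "nat \<Rightarrow> 'a"
  proof -
    have "{..<n} \<inter> S = S" "{..<n} \<inter> - S = {..<n} - S" using that by auto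
    thus ?thesis by (simp add: prod.If_cases)
  qed
  have "(\<Prod>l<n. g l + f l) + (\<Prod>l<n. g l - f l) = (\<Prod>l<n. f l + g l) + (\<Prod>l<n. (- 1) * f l + g l)"
    by (simp add: add.commute)
  also have "\<dots> = (\<Sum>S\<in>Pow {..<n}. (\<Prod>l\<in>S. f l) * (\<Prod>l\<in>{..<n} - S. g l)
      + (- 1) ^ card S * ((\<Prod>l\<in>S. f l) * (\<Prod>l\<in>{..<n} - S. g l)))"
    unfolding sum.distrib by (simp only: prod_add finite_lessThan prod.distrib prod_constant mult.assoc)
  also have "\<dots> = (\<Sum>S\<in>Pow {..<n}. if even (card S) then 2 * (\<Prod>l<n. if l \<in> S then f l else g l) else 0)"
    by (intro sum.cong refl) (simp add: * flip: distrib_right mult_2)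
  also have "\<dots> = (\<Sum>S\<in>{S\<in>Pow {..<n}. even (card S)}. 2 * (\<Prod>l<n. if l \<in> S then f l else g l))"
    by (rule sum.inter_filter[symmetric]) simp
  also have "{S\<in>Pow {..<n}. even (card S)} = even_subsets n" by auto
  finally show ?thesis by (simp add: sum_distrib_left)
qed

lemma card_even_subsets:
  assumes "0 < n"
  shows "card (even_subsets n) = 2 ^ (n - 1)"
proof -
  have "2 * int (card (even_subsets n)) = 2 ^ n"
    using sum_even_subsets[of "\<lambda>_. 1::int" "\<lambda>_. 1" n] assms by simp
  also have "\<dots> = 2 * int (2 ^ (n - 1))"
    using assms by (cases n) auto
  finally show ?thesis by linarith
qed

section \<open>The integer representation and its orbit polynomials\<close>

text \<open>Twice the \<open>l\<close>-th coordinate (from 0) of \<open>\<omega>\<^bsub>j+1\<^esub>\<close>, which is an integer.\<close>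

definition weight2_D :: "nat \<Rightarrow> nat \<Rightarrow> nat \<Rightarrow> int"
  where "weight2_D n l j =
    (if j + 2 < n then (if l \<le> j then 2 else 0) else if j + 2 = n \<and> l + 1 = n then - 1 else 1)"

lemma weight_mat_D_carrier [simp]: "weight_mat_D n \<in> carrier_mat n n"
  unfolding weight_mat_D_def using mat_of_cols_carrier(1)[of n "map (fund_weight_D n) [1..<n + 1]"]
  by (simp del: upt_Suc)

lemma weight_mat_D_index:
  assumes "l < n" "j < n"
  shows "weight_mat_D n $$ (l, j) = of_int (weight2_D n l j) / 2"
proof -
  have "weight_mat_D n $$ (l, j) = fund_weight_D n (j + 1) $ l"
    using assms unfolding weight_mat_D_def by (subst mat_of_cols_index) (auto simp del: upt_Suc)
  thus ?thesis using assms by (auto simp: fund_weight_D_def weight2_D_def)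
qed

text \<open>The rows are the simple coroots \<open>\<epsilon>\<^sub>i - \<epsilon>\<^bsub>i+1\<^esub>\<close> and \<open>\<epsilon>\<^bsub>n-1\<^esub> + \<epsilon>\<^sub>n\<close>, the basis dual to the weights.\<close>

definition coroot_mat_D :: "nat \<Rightarrow> real mat"
  where "coroot_mat_D n = mat n n (\<lambda>(i, k). (if k = i then 1 else 0)
    + (if k = (if i + 1 < n then i + 1 else i - 1) then (if i + 1 < n then - 1 else 1) else 0))"

lemma coroot_mat_D_carrier [simp]: "coroot_mat_D n \<in> carrier_mat n n"
  by (simp add: coroot_mat_D_def)

lemma coroot_mat_D_mult_index:
  assumes A: "A \<in> carrier_mat n n" and "2 \<le> n" "i < n" "j < n"
  shows "(coroot_mat_D n * A) $$ (i, j) =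
    (if i + 1 < n then A $$ (i, j) - A $$ (i + 1, j) else A $$ (i, j) + A $$ (i - 1, j))"
proof -
  \<comment> \<open>The second coordinate in coroot \<open>i\<close> is the next one, except in the
    last row, which adds the last two coordinates and so points back.\<close>
  define m where "m = (if i + 1 < n then i + 1 else i - 1)"
  have m: "m < n" using assms by (auto simp: m_def)
  have "(coroot_mat_D n * A) $$ (i, j) = (\<Sum>k<n. ((if k = i then 1 else 0)
      + (if k = m then (if i + 1 < n then - 1 else 1) else 0)) * A $$ (k, j))"
    using assms unfolding m_def coroot_mat_D_def
    by (simp add: scalar_prod_def atLeast0LessThan del: sum.delta)
  also have "\<dots> = (\<Sum>k<n. (if k = i then A $$ (k, j) else 0)
      + (if k = m then (if i + 1 < n then - 1 else 1) * A $$ (k, j) else 0))"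
    by (intro sum.cong refl) (simp add: distrib_right)
  also have "\<dots> = A $$ (i, j) + (if i + 1 < n then - 1 else 1) * A $$ (m, j)"
    using assms m by (simp add: sum.distrib mult.commute)
  finally show ?thesis by (auto simp: m_def)
qed

lemma coroot_weight_mat_D:
  assumes "3 \<le> n"
  shows "coroot_mat_D n * weight_mat_D n = 1\<^sub>m n"
proof (rule eq_matI)
  fix i j assume "i < dim_row (1\<^sub>m n :: real mat)" "j < dim_col (1\<^sub>m n :: real mat)"
  hence ij: "i < n" "j < n" by auto
  have "(coroot_mat_D n * weight_mat_D n) $$ (i, j) =
    (if i + 1 < n then weight_mat_D n $$ (i, j) - weight_mat_D n $$ (i + 1, j)
     else weight_mat_D n $$ (i, j) + weight_mat_D n $$ (i - 1, j))"
    using coroot_mat_D_mult_index[OF weight_mat_D_carrier] assms ij by simp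
  thus "(coroot_mat_D n * weight_mat_D n) $$ (i, j) = 1\<^sub>m n $$ (i, j)"
    using assms ij by (auto simp: weight_mat_D_index weight2_D_def)
qed (simp_all add: carrier_matD[OF coroot_mat_D_carrier] carrier_matD[OF weight_mat_D_carrier])

lemma weight_coroot_mat_D:
  assumes "3 \<le> n"
  shows "weight_mat_D n * coroot_mat_D n = 1\<^sub>m n"
  by (rule mat_mult_left_right_inverse[OF _ _ coroot_weight_mat_D[OF assms]]) auto

section \<open>Signed permutations and their integer matrices\<close>

lemma signed_perm_mat_carrier [simp]: "signed_perm_mat n \<pi> S \<in> carrier_mat n n"
  by (simp add: signed_perm_mat_def)

text \<open>Rows are addressed as \<open>\<pi> l\<close>, so that no inverse permutation appears and
  the sign is read off at \<open>l\<close>.\<close>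

lemma signed_perm_mat_mult_index:
  assumes A: "A \<in> carrier_mat n n" and \<pi>: "\<pi> permutes {..<n}" and "l < n" "j < n"
  shows "(signed_perm_mat n \<pi> S * A) $$ (\<pi> l, j) = (if l \<in> S then - 1 else 1) * A $$ (l, j)"
proof -
  have eq: "\<pi> l = \<pi> k \<longleftrightarrow> k = l" for k using permutes_inj[OF \<pi>] by (auto dest: injD)
  have less: "\<pi> l < n" using permutes_in_image[OF \<pi>] \<open>l < n\<close> by auto
  have "(signed_perm_mat n \<pi> S * A) $$ (\<pi> l, j) =
    (\<Sum>k<n. if k = l then (if k \<in> S then - 1 else 1) * A $$ (k, j) else 0)"
    using assms less
    by (auto simp: signed_perm_mat_def scalar_prod_def atLeast0LessThan eq simp del: sum.delta intro!: sum.cong)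
  thus ?thesis using \<open>l < n\<close> by simp
qed

lemma signed_perm_mat_inject:
  assumes \<pi>: "\<pi> permutes {..<n}" "\<pi>' permutes {..<n}" and S: "S \<subseteq> {..<n}" "S' \<subseteq> {..<n}"
    and eq: "signed_perm_mat n \<pi> S = signed_perm_mat n \<pi>' S'"
  shows "\<pi> = \<pi>' \<and> S = S'"
proof -
  have *: "\<pi> l = \<pi>' l \<and> (l \<in> S \<longleftrightarrow> l \<in> S')" if l: "l < n" for l
  proof -
    have "\<pi> l < n" using permutes_in_image[OF \<pi>(1)] l by auto
    hence "(if l \<in> S then - 1 else 1) = (if \<pi> l = \<pi>' l then (if l \<in> S' then - 1 else 1) else (0::real))"
      using arg_cong[OF eq, of "\<lambda>M. M $$ (\<pi> l, l)"] l by (simp add: signed_perm_mat_def)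
    thus ?thesis by (auto split: if_splits)
  qed
  have "\<pi> l = \<pi>' l" for l
    using * permutes_not_in[OF \<pi>(1)] permutes_not_in[OF \<pi>(2)] by (cases "l < n") auto
  moreover have "S = S'" using * S by blast
  ultimately show ?thesis by auto
qed

text \<open>The signed permutation written in the basis of weights, since the coroot matrix inverts
  the weight matrix. For a permutation the entries turn out to be integers, so \<open>floor\<close>
  only changes the type.\<close>

definition weyl_int_mat_D :: "nat \<Rightarrow> (nat \<Rightarrow> nat) \<Rightarrow> nat set \<Rightarrow> int mat"
  where "weyl_int_mat_D n \<pi> S =
    map_mat floor (coroot_mat_D n * (signed_perm_mat n \<pi> S * weight_mat_D n))"

lemma weyl_int_mat_D_carrier [simp]: "weyl_int_mat_D n \<pi> S \<in> carrier_mat n n"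
  unfolding weyl_int_mat_D_def map_carrier_mat by (intro mult_carrier_mat[of _ n n]) auto

text \<open>The coordinates of a weight are either all integers or all half-integers.\<close>

lemma of_int_weyl_int_mat_D:
  assumes n: "3 \<le> n" and \<pi>: "\<pi> permutes {..<n}"
  shows "map_mat real_of_int (weyl_int_mat_D n \<pi> S) =
    coroot_mat_D n * (signed_perm_mat n \<pi> S * weight_mat_D n)" (is "_ = ?D * ?A")
proof -
  have A: "?A \<in> carrier_mat n n" by (rule mult_carrier_mat[of _ n n]) auto
  \<comment> \<open>The parity of the doubled entry \<open>t\<close> depends on the column only:
    \<open>j + 2 < n\<close> singles out the weights with integer coordinates, and the last two
    columns hold proper half-integers.\<close>
  have half: "\<exists>t. ?A $$ (k, j) = real_of_int t / 2 \<and> (even t \<longleftrightarrow> j + 2 < n)"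
    if kj: "k < n" "j < n" for k j
  proof -
    obtain l where l: "l < n" "k = \<pi> l"
      using permutes_image[OF \<pi>] kj(1) by (metis imageE lessThan_iff)
    show ?thesis
      using kj(2) l signed_perm_mat_mult_index[OF weight_mat_D_carrier \<pi> l(1) kj(2), of S]
      by (intro exI[of _ "(if l \<in> S then - 1 else 1) * weight2_D n l j"])
        (auto simp: weight_mat_D_index weight2_D_def)
  qed
  have "(?D * ?A) $$ (i, j) \<in> \<int>" if ij: "i < n" "j < n" for i j
  proof -
    define m where "m = (if i + 1 < n then i + 1 else i - 1)"
    have m: "m < n" using n ij by (auto simp: m_def)
    obtain t where t: "?A $$ (i, j) = real_of_int t / 2" "even t \<longleftrightarrow> j + 2 < n"
      using half[OF ij] by auto
    obtain u where u: "?A $$ (m, j) = real_of_int u / 2" "even u \<longleftrightarrow> j + 2 < n"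
      using half[OF m ij(2)] by auto
    \<comment> \<open>Within a column the doubled entries have equal parity, so sums and differences
      of two entries are integers. The rows of the coroot matrix produce exactly these.\<close>
    have "even (t - u)" "even (t + u)" using t(2) u(2) by auto
    then obtain a b where ab: "t - u = 2 * a" "t + u = 2 * b" by (meson evenE)
    have "?A $$ (i, j) - ?A $$ (m, j) = of_int a" "?A $$ (i, j) + ?A $$ (m, j) = of_int b"
      using ab[THEN arg_cong[of _ _ real_of_int]] unfolding t(1) u(1) by simp_all
    thus ?thesis
      using coroot_mat_D_mult_index[OF A _ ij] n unfolding m_def by auto
  qed
  thus ?thesis
    using A by (intro eq_matI) (auto simp: weyl_int_mat_D_def coroot_mat_D_def weight_mat_D_def)
qed

lemma weight_mult_weyl_int_mat_D:
  assumes n: "3 \<le> n" and \<pi>: "\<pi> permutes {..<n}"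
  shows "signed_perm_mat n \<pi> S * weight_mat_D n
    = weight_mat_D n * map_mat real_of_int (weyl_int_mat_D n \<pi> S)"
proof -
  let ?A = "signed_perm_mat n \<pi> S * weight_mat_D n"
  have A: "?A \<in> carrier_mat n n" by (rule mult_carrier_mat[of _ n n]) auto
  have "weight_mat_D n * (coroot_mat_D n * ?A) = (weight_mat_D n * coroot_mat_D n) * ?A"
    using A by (simp add: assoc_mult_mat[of _ n n _ n _ n])
  thus ?thesis
    by (simp add: of_int_weyl_int_mat_D[OF assms] weight_coroot_mat_D[OF n] left_mult_one_mat[OF A])
qed

text \<open>Turns sums over the group into double sums over permutations and even sign sets. As the
  weight matrix is invertible, a signed permutation and its integer matrix determine each
  other.\<close>

lemma bij_betw_integer_rep_D:
  assumes n: "3 \<le> n"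
  shows "bij_betw (\<lambda>(\<pi>, S). weyl_int_mat_D n \<pi> S)
    ({\<pi>. \<pi> permutes {..<n}} \<times> even_subsets n) (integer_rep_D n)"
proof (rule bij_betw_imageI)
  show "inj_on (\<lambda>(\<pi>, S). weyl_int_mat_D n \<pi> S) ({\<pi>. \<pi> permutes {..<n}} \<times> even_subsets n)"
  proof (rule inj_onI, clarify)
    fix \<pi> S \<pi>' S'
    assume \<pi>: "\<pi> permutes {..<n}" "\<pi>' permutes {..<n}" and S: "S \<subseteq> {..<n}" "S' \<subseteq> {..<n}"
      and eq: "weyl_int_mat_D n \<pi> S = weyl_int_mat_D n \<pi>' S'"
    have "signed_perm_mat n \<pi> S * weight_mat_D n = signed_perm_mat n \<pi>' S' * weight_mat_D n"
      using weight_mult_weyl_int_mat_D[OF n \<pi>(1)] weight_mult_weyl_int_mat_D[OF n \<pi>(2)] eq by simp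
    hence "signed_perm_mat n \<pi> S * weight_mat_D n * coroot_mat_D n
      = signed_perm_mat n \<pi>' S' * weight_mat_D n * coroot_mat_D n" by simp
    hence "signed_perm_mat n \<pi> S = signed_perm_mat n \<pi>' S'"
      by (simp add: assoc_mult_mat[of _ n n _ n _ n] weight_coroot_mat_D[OF n]
        right_mult_one_mat[OF signed_perm_mat_carrier])
    thus "\<pi> = \<pi>' \<and> S = S'" by (rule signed_perm_mat_inject[OF \<pi> S])
  qed
next
  show "(\<lambda>(\<pi>, S). weyl_int_mat_D n \<pi> S) ` ({\<pi>. \<pi> permutes {..<n}} \<times> even_subsets n) = integer_rep_D n"
  proof (intro equalityI subsetI)
    fix B assume "B \<in> (\<lambda>(\<pi>, S). weyl_int_mat_D n \<pi> S) ` ({\<pi>. \<pi> permutes {..<n}} \<times> even_subsets n)"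
    then obtain \<pi> S where \<pi>: "\<pi> permutes {..<n}" and S: "S \<subseteq> {..<n}" "even (card S)"
      and B: "B = weyl_int_mat_D n \<pi> S" by auto
    show "B \<in> integer_rep_D n"
      unfolding integer_rep_D_def weyl_group_D_def B
      using \<pi> S weight_mult_weyl_int_mat_D[OF n \<pi>] by auto
  next
    fix B assume "B \<in> integer_rep_D n"
    then obtain \<pi> S where \<pi>: "\<pi> permutes {..<n}" and S: "S \<subseteq> {..<n}" "even (card S)"
      and Bc: "B \<in> carrier_mat n n"
      and B: "signed_perm_mat n \<pi> S * weight_mat_D n = weight_mat_D n * map_mat real_of_int B"
      unfolding integer_rep_D_def weyl_group_D_def by auto
    have "map_mat real_of_int (weyl_int_mat_D n \<pi> S) =
      coroot_mat_D n * (weight_mat_D n * map_mat real_of_int B)"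
      by (simp add: of_int_weyl_int_mat_D[OF n \<pi>] B)
    also have "\<dots> = coroot_mat_D n * weight_mat_D n * map_mat real_of_int B"
      using Bc by (simp add: assoc_mult_mat[of _ n n _ n _ n])
    also have "\<dots> = map_mat real_of_int B"
      using Bc by (simp add: coroot_weight_mat_D[OF n])
    finally have "B = weyl_int_mat_D n \<pi> S" by (rule of_int_hom.mat_hom_inj[symmetric])
    thus "B \<in> (\<lambda>(\<pi>, S). weyl_int_mat_D n \<pi> S) ` ({\<pi>. \<pi> permutes {..<n}} \<times> even_subsets n)"
      using \<pi> S by auto
  qed
qed

lemma card_integer_rep_D:
  assumes n: "3 \<le> n"
  shows "card (integer_rep_D n) = fact n * 2 ^ (n - 1)"
  using bij_betw_same_card[OF bij_betw_integer_rep_D[OF n]] n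
  by (simp add: card_cartesian_product card_permutations[of _ n] card_even_subsets)

section \<open>Laurent monomials and orbit averages in coordinates on the torus\<close>

lemma prod_power_int: "(\<Prod>i\<in>I. f i) powi m = (\<Prod>i\<in>I. f i powi m :: 'a::field)"
  by (induction I rule: infinite_finite_induct) (auto simp: power_int_mult_distrib)

lemma power_int_sum:
  assumes "x \<noteq> (0::'a::field)"
  shows "x powi (\<Sum>i\<in>I. f i) = (\<Prod>i\<in>I. x powi f i)"
  by (induction I rule: infinite_finite_induct) (auto simp: power_int_add assms)

text \<open>With \<open>s k = exp (i t_k / 2)\<close>, each coordinate is the exponential of i times
  the pairing of a weight with t. Half angles are used because weights have half-integer
  coordinates.\<close>

definition torus_point_D :: "nat \<Rightarrow> (nat \<Rightarrow> complex) \<Rightarrow> complex vec"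
  where "torus_point_D n s = vec n (\<lambda>i. \<Prod>k<n. s k powi weight2_D n k i)"

text \<open>The exponents of the \<open>s k\<close> are the doubled coordinates of the transformed
  weight. At position \<open>\<pi> l\<close> this is the coordinate \<open>l\<close> of the original
  weight, up to sign.\<close>

lemma laurent_monom_torus_point_D:
  assumes n: "3 \<le> n" and \<pi>: "\<pi> permutes {..<n}" and s: "\<forall>k<n. s k \<noteq> 0" and j: "j < n"
  shows "laurent_monom (torus_point_D n s) (weyl_int_mat_D n \<pi> S *\<^sub>v unit_vec n j)
    = (\<Prod>l<n. s (\<pi> l) powi ((if l \<in> S then - 1 else 1) * weight2_D n l j))"
proof -
  let ?B = "weyl_int_mat_D n \<pi> S"
  have B: "?B \<in> carrier_mat n n" by simp
  have exponent: "(\<Sum>i<n. weight2_D n (\<pi> l) i * ?B $$ (i, j)) = (if l \<in> S then - 1 else 1) * weight2_D n l j"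
    if l: "l < n" for l
  proof -
    have \<pi>l: "\<pi> l < n" using permutes_in_image[OF \<pi>] l by auto
    have "(\<Sum>i<n. real_of_int (weight2_D n (\<pi> l) i) / 2 * real_of_int (?B $$ (i, j))) =
      (weight_mat_D n * map_mat real_of_int ?B) $$ (\<pi> l, j)"
      using \<pi>l j carrier_matD[OF B] carrier_matD[OF weight_mat_D_carrier[of n]]
      by (auto simp: scalar_prod_def atLeast0LessThan weight_mat_D_index intro!: sum.cong)
    also have "\<dots> = (signed_perm_mat n \<pi> S * weight_mat_D n) $$ (\<pi> l, j)"
      by (simp add: weight_mult_weyl_int_mat_D[OF n \<pi>])
    also have "\<dots> = (if l \<in> S then - 1 else 1) * (real_of_int (weight2_D n l j) / 2)"
      using signed_perm_mat_mult_index[OF weight_mat_D_carrier \<pi> l j] l j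
      by (simp add: weight_mat_D_index)
    finally have "(\<Sum>i<n. real_of_int (weight2_D n (\<pi> l) i) * real_of_int (?B $$ (i, j)))
      = (if l \<in> S then - 1 else 1) * real_of_int (weight2_D n l j)"
      by (simp flip: sum_divide_distrib)
    hence "real_of_int (\<Sum>i<n. weight2_D n (\<pi> l) i * ?B $$ (i, j))
      = real_of_int ((if l \<in> S then - 1 else 1) * weight2_D n l j)" by simp
    thus ?thesis by (simp only: of_int_eq_iff)
  qed
  have "(?B *\<^sub>v unit_vec n j) $ i = ?B $$ (i, j)" if "i < n" for i
    using that j carrier_matD[OF B] by (simp add: scalar_prod_right_unit)
  hence "laurent_monom (torus_point_D n s) (?B *\<^sub>v unit_vec n j)
    = (\<Prod>i<n. (\<Prod>k<n. s k powi weight2_D n k i) powi (?B $$ (i, j)))"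
    by (auto simp: laurent_monom_def torus_point_D_def intro!: prod.cong)
  also have "\<dots> = (\<Prod>k<n. \<Prod>i<n. s k powi (weight2_D n k i * ?B $$ (i, j)))"
    unfolding prod_power_int by (subst prod.swap) (simp add: power_int_mult)
  also have "\<dots> = (\<Prod>k<n. s k powi (\<Sum>i<n. weight2_D n k i * ?B $$ (i, j)))"
    by (intro prod.cong refl power_int_sum[symmetric]) (use s in auto)
  also have "\<dots> = (\<Prod>l<n. s (\<pi> l) powi (\<Sum>i<n. weight2_D n (\<pi> l) i * ?B $$ (i, j)))"
    by (subst prod.permute[OF \<pi>]) simp
  finally show ?thesis by (simp add: exponent)
qed

text \<open>For fixed \<open>\<pi>\<close>, \<open>sum_even_subsets\<close> evaluates the sum over
  signs. Its factor 2 turns the group order \<open>fact n * 2 ^ (n - 1)\<close> into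
  \<open>fact n * 2 ^ n\<close>.\<close>

lemma orbit_poly_torus_point_D:
  assumes n: "3 \<le> n" and s: "\<forall>k<n. s k \<noteq> 0" and j: "j < n"
  shows "of_nat (fact n * 2 ^ n) * orbit_poly_D n (j + 1) (torus_point_D n s) =
    (\<Sum>\<pi> | \<pi> permutes {..<n}.
      (\<Prod>l<n. s (\<pi> l) powi weight2_D n l j + inverse (s (\<pi> l) powi weight2_D n l j))
      + (\<Prod>l<n. s (\<pi> l) powi weight2_D n l j - inverse (s (\<pi> l) powi weight2_D n l j)))"
proof -
  let ?u = "\<lambda>\<pi> l. s (\<pi> l) powi weight2_D n l j"
  have "(\<Sum>B \<in> integer_rep_D n. laurent_monom (torus_point_D n s) (B *\<^sub>v unit_vec n j)) =
    (\<Sum>(\<pi>, S) \<in> {\<pi>. \<pi> permutes {..<n}} \<times> even_subsets n.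
      laurent_monom (torus_point_D n s) (weyl_int_mat_D n \<pi> S *\<^sub>v unit_vec n j))"
    by (subst sum.reindex_bij_betw[OF bij_betw_integer_rep_D[OF n], symmetric]) (simp add: case_prod_beta)
  also have "\<dots> = (\<Sum>\<pi> | \<pi> permutes {..<n}. \<Sum>S\<in>even_subsets n.
      \<Prod>l<n. if l \<in> S then inverse (?u \<pi> l) else ?u \<pi> l)"
    unfolding sum.cartesian_product[symmetric]
    by (intro sum.cong refl) 
      (auto simp: laurent_monom_torus_point_D[OF n _ s j] power_int_minus intro!: prod.cong)
  finally have sum: "2 * (\<Sum>B \<in> integer_rep_D n. laurent_monom (torus_point_D n s) (B *\<^sub>v unit_vec n j)) =
    (\<Sum>\<pi> | \<pi> permutes {..<n}. (\<Prod>l<n. ?u \<pi> l + inverse (?u \<pi> l)) + (\<Prod>l<n. ?u \<pi> l - inverse (?u \<pi> l)))"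
    by (simp only: sum_distrib_left[of 2 _ "{\<pi>. \<pi> permutes {..<n}}"] sum_even_subsets)
  have "of_nat (fact n * 2 ^ n) = (2::complex) * of_nat (card (integer_rep_D n))"
    using n by (cases n) (auto simp: card_integer_rep_D)
  moreover have "of_nat (card (integer_rep_D n)) \<noteq> (0::complex)"
    using n by (simp add: card_integer_rep_D)
  ultimately show ?thesis
    by (simp add: orbit_poly_D_def sum)
qed

text \<open>The last coordinate of the weight is 0, which kills the product of differences. In the
  product of sums the first \<open>i\<close> factors are \<open>2 * ?c (\<pi> l)\<close> and the
  others are 2, so averaging over permutations gives \<open>esym\<close>.\<close>

lemma orbit_poly_D_esym:
  assumes n: "3 \<le> n" and s: "\<forall>k<n. s k \<noteq> 0" and i: "1 \<le> i" "i \<le> n - 2"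
  shows "of_nat (n choose i) * orbit_poly_D n i (torus_point_D n s) =
    esym n i (\<lambda>k. ((s k)\<^sup>2 + inverse ((s k)\<^sup>2)) / 2)" (is "_ = esym n i ?c")
proof -
  obtain j where j: "i = j + 1" "j + 2 < n" using i n by (cases i) auto
  have summand: "(\<Prod>l<n. s (\<pi> l) powi weight2_D n l j + inverse (s (\<pi> l) powi weight2_D n l j))
      + (\<Prod>l<n. s (\<pi> l) powi weight2_D n l j - inverse (s (\<pi> l) powi weight2_D n l j))
    = 2 ^ n * (\<Prod>l<i. ?c (\<pi> l))" for \<pi>
  proof -
    have "(\<Prod>l<n. s (\<pi> l) powi weight2_D n l j - inverse (s (\<pi> l) powi weight2_D n l j)) = 0"
      using j by (intro prod_zero) (auto intro!: bexI[of _ "n - 1"] simp: weight2_D_def)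
    moreover have "(\<Prod>l<n. s (\<pi> l) powi weight2_D n l j + inverse (s (\<pi> l) powi weight2_D n l j))
      = (\<Prod>l<n. 2 * (if l < i then ?c (\<pi> l) else 1))"
      using j by (intro prod.cong) (auto simp: weight2_D_def)
    moreover have "(\<Prod>l<n. if l < i then ?c (\<pi> l) else 1) = (\<Prod>l<i. ?c (\<pi> l))"
      using j by (simp add: prod.If_cases Int_absorb1 lessThan_def[symmetric] subset_eq)
    ultimately show ?thesis by (simp add: prod.distrib)
  qed
  have "of_nat (fact n * 2 ^ n) * (of_nat (n choose i) * orbit_poly_D n i (torus_point_D n s))
    = of_nat (n choose i) * (of_nat (fact n * 2 ^ n) * orbit_poly_D n (j + 1) (torus_point_D n s))"
    by (simp add: j(1) mult_ac)
  also have "\<dots> = of_nat (n choose i) * (\<Sum>\<pi> | \<pi> permutes {..<n}. 2 ^ n * (\<Prod>l<i. ?c (\<pi> l)))"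
    using j by (subst orbit_poly_torus_point_D[OF n s]) (auto simp: summand)
  also have "\<dots> = 2 ^ n * (of_nat (n choose i) * (\<Sum>\<pi> | \<pi> permutes {..<n}. (\<Prod>l<i. ?c (\<pi> l))))"
    by (simp only: sum_distrib_left mult_ac)
  also have "\<dots> = of_nat (fact n * 2 ^ n) * esym n i ?c"
    using j by (subst sum_permutations_prod) auto
  finally show ?thesis by (simp del: of_nat_mult of_nat_power)
qed

text \<open>The last two weights have doubled coordinates 1 or -1, so the products run over all
  \<open>s l\<close> and are independent of the permutation. The weights differ by one sign, which
  fixes the product of sums and negates that of differences.\<close>

lemma orbit_poly_D_spin:
  assumes n: "3 \<le> n" and s: "\<forall>k<n. s k \<noteq> 0"
  shows "2 ^ n * orbit_poly_D n n (torus_point_D n s) =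
      (\<Prod>l<n. s l + inverse (s l)) + (\<Prod>l<n. s l - inverse (s l))"
    and "2 ^ n * orbit_poly_D n (n - 1) (torus_point_D n s) =
      (\<Prod>l<n. s l + inverse (s l)) - (\<Prod>l<n. s l - inverse (s l))"
proof -
  have perm: "(\<Prod>l<n. f (\<pi> l)) = (\<Prod>l<n. f l :: complex)" if "\<pi> permutes {..<n}" for \<pi> f
    using prod.permute[OF that, of f] by simp
  have "of_nat (fact n) * (2 ^ n * orbit_poly_D n n (torus_point_D n s))
    = of_nat (fact n * 2 ^ n) * orbit_poly_D n (n - 1 + 1) (torus_point_D n s)"
    using n by simp
  also have "\<dots> = (\<Sum>\<pi> | \<pi> permutes {..<n}. (\<Prod>l<n. s (\<pi> l) + inverse (s (\<pi> l)))
      + (\<Prod>l<n. s (\<pi> l) - inverse (s (\<pi> l))))"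
    using n by (subst orbit_poly_torus_point_D[OF n s]) (auto simp: weight2_D_def)
  also have "\<dots> = (\<Sum>\<pi> | \<pi> permutes {..<n}. (\<Prod>l<n. s l + inverse (s l)) + (\<Prod>l<n. s l - inverse (s l)))"
    by (intro sum.cong refl arg_cong2[where f = "(+)"]; rule perm) simp_all
  also have "\<dots> = of_nat (fact n) * ((\<Prod>l<n. s l + inverse (s l)) + (\<Prod>l<n. s l - inverse (s l)))"
    by (simp add: card_permutations[of _ n])
  finally show "2 ^ n * orbit_poly_D n n (torus_point_D n s) =
      (\<Prod>l<n. s l + inverse (s l)) + (\<Prod>l<n. s l - inverse (s l))" by simp

  \<comment> \<open>The sign of the last coordinate: inverting one factor keeps its sum with the
    inverse and negates the difference.\<close>
  let ?e = "\<lambda>l. if l = n - 1 then - 1 else 1 :: complex"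
  have w: "s (\<pi> l) powi weight2_D n l (n - 2) + inverse (s (\<pi> l) powi weight2_D n l (n - 2)) = s (\<pi> l) + inverse (s (\<pi> l))"
    "s (\<pi> l) powi weight2_D n l (n - 2) - inverse (s (\<pi> l) powi weight2_D n l (n - 2)) = ?e l * (s (\<pi> l) - inverse (s (\<pi> l)))"
    if "l < n" for l \<pi>
    using n that by (auto simp: weight2_D_def power_int_minus)
  have e: "(\<Prod>l<n. ?e l) = - 1" using n by (simp add: prod.delta)
  have "of_nat (fact n) * (2 ^ n * orbit_poly_D n (n - 1) (torus_point_D n s))
    = of_nat (fact n * 2 ^ n) * orbit_poly_D n (n - 2 + 1) (torus_point_D n s)"
    using n by (simp add: numeral_2_eq_2 Suc_diff_Suc)
  also have "\<dots> = (\<Sum>\<pi> | \<pi> permutes {..<n}. (\<Prod>l<n. s (\<pi> l) + inverse (s (\<pi> l)))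
      + (\<Prod>l<n. ?e l * (s (\<pi> l) - inverse (s (\<pi> l)))))"
    using n by (subst orbit_poly_torus_point_D[OF n s])
      (auto simp: w intro!: sum.cong arg_cong2[where f = "(+)"] prod.cong)
  also have "\<dots> = (\<Sum>\<pi> | \<pi> permutes {..<n}. (\<Prod>l<n. s (\<pi> l) + inverse (s (\<pi> l)))
      - (\<Prod>l<n. s (\<pi> l) - inverse (s (\<pi> l))))"
    by (simp only: prod.distrib e) simp
  also have "\<dots> = (\<Sum>\<pi> | \<pi> permutes {..<n}. (\<Prod>l<n. s l + inverse (s l)) - (\<Prod>l<n. s l - inverse (s l)))"
    by (intro sum.cong refl arg_cong2[where f = "(-)"]; rule perm) simp_all
  also have "\<dots> = of_nat (fact n) * ((\<Prod>l<n. s l + inverse (s l)) - (\<Prod>l<n. s l - inverse (s l)))"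
    by (simp add: card_permutations[of _ n])
  finally show "2 ^ n * orbit_poly_D n (n - 1) (torus_point_D n s) =
      (\<Prod>l<n. s l + inverse (s l)) - (\<Prod>l<n. s l - inverse (s l))" by simp
qed

section \<open>The Hermite matrix as a quadratic form\<close>

text \<open>Induction with expansion along the first row, where only the corner and the last column
  contribute. The corner minor has the same shape with shifted coefficients, hence the general
  \<open>a\<close>; the other minor is triangular with diagonal -1.\<close>

lemma det_companion:
  fixes x :: "'a::comm_ring_1"
  shows "det (mat n n (\<lambda>(i, j). (if i = j then x else 0)
      + (if j = n - 1 then a i else if i = j + 1 then - 1 else 0))) = x ^ n + (\<Sum>i<n. a i * x ^ i)"
    (is "det (?M n a) = _")
proof (induction n arbitrary: a)
  case 0
  show ?case by (simp add: det_dim_zero)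
next
  case (Suc n)
  show ?case
  proof (cases "n = 0")
    case True
    thus ?thesis by (simp add: det_single)
  next
    case False
    let ?A = "?M (Suc n) a"
    have A: "?A \<in> carrier_mat (Suc n) (Suc n)" by simp
    have "mat_delete ?A 0 0 = ?M n (\<lambda>i. a (Suc i))"
      using False by (intro eq_matI) (auto simp: mat_delete_def)
    hence cofactor_0: "cofactor ?A 0 0 = x ^ n + (\<Sum>i<n. a (Suc i) * x ^ i)"
      unfolding cofactor_def by (simp only: Suc.IH) simp
    let ?N = "mat_delete ?A 0 n"
    have N: "?N \<in> carrier_mat n n" by (simp add: mat_delete_def)
    have "upper_triangular ?N"
      using False by (intro upper_triangularI) (auto simp: mat_delete_def)
    hence "det ?N = prod_list (diag_mat ?N)" using N by (rule det_upper_triangular)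
    also have "diag_mat ?N = map (\<lambda>_. - 1) [0..<n]"
      using False by (auto simp: diag_mat_def mat_delete_def)
    also have "prod_list \<dots> = (- 1) ^ n" by (simp add: map_replicate_const)
    finally have cofactor_n: "cofactor ?A 0 n = 1" unfolding cofactor_def
      by (simp flip: power_add mult_2)
    have "det ?A = (\<Sum>j<Suc n. ?A $$ (0, j) * cofactor ?A 0 j)"
      by (rule laplace_expansion_row[OF A]) simp
    also have "\<dots> = (\<Sum>j\<in>{0, n}. ?A $$ (0, j) * cofactor ?A 0 j)"
      by (rule sum.mono_neutral_right) auto
    also have "\<dots> = x * cofactor ?A 0 0 + a 0 * cofactor ?A 0 n"
      using False by simp
    also have "\<dots> = x ^ Suc n + (\<Sum>i<Suc n. a i * x ^ i)"
      unfolding cofactor_0 cofactor_n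
      by (simp add: sum.lessThan_Suc_shift algebra_simps sum_distrib_left del: sum.lessThan_Suc)
    finally show ?thesis .
  qed
qed

lemma companion_D_carrier [simp]: "companion_D n z \<in> carrier_mat n n"
  by (simp add: companion_D_def)

lemma char_poly_companion_D:
  assumes "0 < n"
  shows "char_poly (companion_D n z) =
    monom 1 n + (\<Sum>i\<in>{1..n}. monom (char_coeff_D n z i) (n - i))"
proof -
  let ?a = "\<lambda>i. [:char_coeff_D n z (n - i):]"
  have "char_poly_matrix (companion_D n z) = mat n n (\<lambda>(i, j). (if i = j then [:0, 1:] else 0)
      + (if j = n - 1 then ?a i else if i = j + 1 then - 1 else 0))"
    by (intro eq_matI) (auto simp: char_poly_matrix_def companion_D_def one_pCons)
  hence "char_poly (companion_D n z) = [:0, 1:] ^ n + (\<Sum>i<n. ?a i * [:0, 1:] ^ i)"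
    unfolding char_poly_def by (simp only: det_companion)
  also have "\<dots> = monom 1 n + (\<Sum>i<n. monom (char_coeff_D n z (n - i)) i)"
    by (simp add: monom_altdef)
  also have "(\<Sum>i<n. monom (char_coeff_D n z (n - i)) i) =
      (\<Sum>i\<in>{1..n}. monom (char_coeff_D n z i) (n - i))"
    by (rule sum.reindex_bij_witness[of _ "\<lambda>i. n - i" "\<lambda>i. n - i"]) auto
  finally show ?thesis .
qed

text \<open>Vieta's formulas. The coefficient equations serve later as the way to say that
  \<open>r\<close> lists the roots with multiplicity.\<close>

lemma char_poly_companion_D_eq_iff:
  assumes "0 < n"
  shows "char_poly (companion_D n z) = (\<Prod>l<n. [:- r l, 1:]) \<longleftrightarrow>
    (\<forall>i\<in>{1..n}. char_coeff_D n z i = (- 1) ^ i * esym n i r)"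
proof -
  have "{..n} = insert 0 {1..n}" by auto
  hence P: "(\<Prod>l<n. [:- r l, 1:]) =
      monom 1 n + (\<Sum>i\<in>{1..n}. monom ((- 1) ^ i * esym n i r) (n - i))"
    by (simp add: prod_linear_esym)
  have c: "coeff (\<Sum>i\<in>{1..n}. monom (f i) (n - i)) (n - j) = f j"
    if j: "j \<in> {1..n}" for f :: "nat \<Rightarrow> 'a" and j
  proof -
    have "coeff (\<Sum>i\<in>{1..n}. monom (f i) (n - i)) (n - j) = (\<Sum>i\<in>{1..n}. if i = j then f i else 0)"
      unfolding coeff_sum using j by (intro sum.cong) auto
    thus ?thesis using j by simp
  qed
  show ?thesis
  proof
    assume "char_poly (companion_D n z) = (\<Prod>l<n. [:- r l, 1:])"
    hence eq: "(\<Sum>i\<in>{1..n}. monom (char_coeff_D n z i) (n - i))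
      = (\<Sum>i\<in>{1..n}. monom ((- 1) ^ i * esym n i r) (n - i))"
      unfolding char_poly_companion_D[OF assms] P by simp
    show "\<forall>i\<in>{1..n}. char_coeff_D n z i = (- 1) ^ i * esym n i r"
    proof
      fix i assume i: "i \<in> {1..n}"
      show "char_coeff_D n z i = (- 1) ^ i * esym n i r"
        using arg_cong[OF eq, of "\<lambda>p. coeff p (n - i)"] unfolding c[OF i] .
    qed
  qed (simp add: char_poly_companion_D[OF assms] P)
qed

section \<open>Traces of powers and the quadratic form\<close>

lemma mat_trace_mult_commute:
  fixes A B :: "'a::comm_semiring_0 mat"
  assumes "A \<in> carrier_mat n m" "B \<in> carrier_mat m n"
  shows "mat_trace (A * B) = mat_trace (B * A)"
proof -
  have "mat_trace (A * B) = (\<Sum>i<n. \<Sum>k<m. A $$ (i, k) * B $$ (k, i))"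
    using assms by (simp add: mat_trace_def scalar_prod_def atLeast0LessThan)
  also have "\<dots> = (\<Sum>k<m. \<Sum>i<n. B $$ (k, i) * A $$ (i, k))"
    by (subst sum.swap) (simp add: mult.commute)
  also have "\<dots> = mat_trace (B * A)"
    using assms by (simp add: mat_trace_def scalar_prod_def atLeast0LessThan)
  finally show ?thesis .
qed

lemma mat_trace_minus:
  fixes A B :: "'a::ab_group_add mat"
  assumes "A \<in> carrier_mat n n" "B \<in> carrier_mat n n"
  shows "mat_trace (A - B) = mat_trace A - mat_trace B"
  using assms by (simp add: mat_trace_def sum_subtractf)

lemma upper_triangular_pow:
  fixes B :: "'a::comm_ring_1 mat"
  assumes B: "B \<in> carrier_mat n n" and ut: "upper_triangular B"
  shows "(\<forall>i<n. \<forall>j<i. (B ^\<^sub>m k) $$ (i, j) = 0) \<and> (\<forall>i<n. (B ^\<^sub>m k) $$ (i, i) = (B $$ (i, i)) ^ k)"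
proof (induction k)
  case 0
  show ?case using B by auto
next
  case (Suc k)
  have B0: "B $$ (i, j) = 0" if "j < i" "i < n" for i j
    using upper_triangularD[OF ut, of j i] that B by auto
  have Bk: "B ^\<^sub>m k \<in> carrier_mat n n" using B by simp
  have index: "(B ^\<^sub>m Suc k) $$ (i, j) = (\<Sum>l<n. (B ^\<^sub>m k) $$ (i, l) * B $$ (l, j))"
    if "i < n" "j < n" for i j
    using that B carrier_matD[OF Bk] by (simp add: scalar_prod_def atLeast0LessThan)
  have "(B ^\<^sub>m Suc k) $$ (i, j) = 0" if ij: "i < n" "j < i" for i j
  proof -
    have "(B ^\<^sub>m k) $$ (i, l) * B $$ (l, j) = 0" if "l < n" for l
      using Suc ij that B0[of j l] by (cases "l < i") auto
    thus ?thesis using ij index[of i j] by simp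
  qed
  moreover have "(B ^\<^sub>m Suc k) $$ (i, i) = (B $$ (i, i)) ^ Suc k" if i: "i < n" for i
  proof -
    have "(B ^\<^sub>m k) $$ (i, l) * B $$ (l, i) = (if l = i then (B $$ (i, i)) ^ Suc k else 0)" if "l < n" for l
      using Suc i that B0[of i l] by (cases l i rule: linorder_cases) auto
    thus ?thesis using i index[of i i] by simp
  qed
  ultimately show ?case by simp
qed

text \<open>Schur triangularization puts the roots on the diagonal, where powers act entrywise, and
  the trace is invariant under similarity.\<close>

lemma mat_trace_pow:
  fixes A :: "complex mat"
  assumes A: "A \<in> carrier_mat n n" and c: "char_poly A = (\<Prod>l<n. [:- r l, 1:])"
  shows "mat_trace (A ^\<^sub>m k) = (\<Sum>l<n. r l ^ k)"
proof -
  define es where "es = map r [0..<n]"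
  have "char_poly A = (\<Prod>e\<leftarrow>es. [:- e, 1:])"
    by (simp add: c es_def prod.list_conv_set_nth atLeast0LessThan)
  moreover obtain B P Q where "schur_decomposition A es = (B, P, Q)"
    by (cases "schur_decomposition A es") auto
  ultimately have wit: "similar_mat_wit A B P Q" and ut: "upper_triangular B" and diag: "diag_mat B = es"
    using schur_decomposition[OF A] by blast+
  note w = similar_mat_witD2[OF A wit]
  have Bk: "B ^\<^sub>m k \<in> carrier_mat n n" using w(5) by simp
  have "mat_trace (A ^\<^sub>m k) = mat_trace (P * (B ^\<^sub>m k * Q))"
    using similar_mat_wit_pow_id[OF wit, of k] w(6,7) Bk by (simp add: assoc_mult_mat[of _ n n _ n _ n])
  also have "\<dots> = mat_trace (B ^\<^sub>m k * Q * P)"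
    using w(6,7) Bk by (intro mat_trace_mult_commute[of _ n n] mult_carrier_mat[of _ n n])
  also have "B ^\<^sub>m k * Q * P = B ^\<^sub>m k"
    using w(2,6,7) Bk by (simp add: assoc_mult_mat[of _ n n _ n _ n] right_mult_one_mat[OF Bk])
  also have "mat_trace (B ^\<^sub>m k) = (\<Sum>l<n. (B $$ (l, l)) ^ k)"
    using upper_triangular_pow[OF w(5) ut, of k] carrier_matD[OF Bk] by (simp add: mat_trace_def)
  also have "\<dots> = (\<Sum>l<n. r l ^ k)"
  proof (intro sum.cong refl)
    fix l assume "l \<in> {..<n}"
    hence "B $$ (l, l) = es ! l" using w(5) by (simp add: diag[symmetric] diag_mat_def)
    thus "(B $$ (l, l)) ^ k = r l ^ k" using \<open>l \<in> {..<n}\<close> by (simp add: es_def)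
  qed
  finally show ?thesis .
qed

lemma hermite_mat_D_carrier [simp]: "hermite_mat_D n z \<in> carrier_mat n n"
  by (simp add: hermite_mat_D_def)

text \<open>A difference of two power sums of the roots. The powers stay in two factors so that the
  quadratic form becomes a weighted sum of squares.\<close>

lemma hermite_mat_D_index:
  fixes z :: "complex vec"
  assumes "i < n" "j < n"
    and c: "\<forall>i\<in>{1..n}. char_coeff_D n z i = (- 1) ^ i * esym n i r"
  shows "hermite_mat_D n z $$ (i, j) = (\<Sum>l<n. (1 - (r l)\<^sup>2) * r l ^ i * r l ^ j)"
proof -
  let ?C = "companion_D n z"
  have Ck: "?C ^\<^sub>m k \<in> carrier_mat n n" for k by simp
  have "char_poly ?C = (\<Prod>l<n. [:- r l, 1:])"
    using c assms by (subst char_poly_companion_D_eq_iff) auto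
  note trace = mat_trace_pow[OF companion_D_carrier this]
  have "hermite_mat_D n z $$ (i, j) = mat_trace (?C ^\<^sub>m (i + j)) - mat_trace (?C ^\<^sub>m (i + j + 2))"
    using assms(1,2) mat_trace_minus[OF Ck Ck] by (simp add: hermite_mat_D_def del: pow_mat.simps add_2_eq_Suc')
  also have "\<dots> = (\<Sum>l<n. (1 - (r l)\<^sup>2) * r l ^ i * r l ^ j)"
    unfolding trace sum_subtractf[symmetric] by (intro sum.cong refl) (simp add: power_add algebra_simps power2_eq_square)
  finally show ?thesis .
qed

lemma exists_char_roots_D:
  fixes z :: "complex vec"
  assumes "0 < n"
  shows "\<exists>r. \<forall>i\<in>{1..n}. char_coeff_D n z i = (- 1) ^ i * esym n i r"
proof -
  obtain es where es: "char_poly (companion_D n z) = (\<Prod>a\<leftarrow>es. [:- a, 1:])" "length es = n"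
    using char_poly_factorized[OF companion_D_carrier] by blast
  hence "char_poly (companion_D n z) = (\<Prod>l<n. [:- (es ! l), 1:])"
    by (simp add: prod.list_conv_set_nth atLeast0LessThan)
  thus ?thesis using char_poly_companion_D_eq_iff[OF assms] by blast
qed

text \<open>Summing over both indices leaves, for each root, the square of the polynomial with
  coefficients \<open>v\<close>. Roots may be complex, so these are squares and not squared
  moduli.\<close>

lemma hermite_quadratic_form:
  fixes z :: "complex vec"
  assumes c: "\<forall>i\<in>{1..n}. char_coeff_D n z i = (- 1) ^ i * esym n i r"
    and v: "v \<in> carrier_vec n"
  shows "v \<bullet> (map_mat Re (hermite_mat_D n z) *\<^sub>v v) =
    Re (\<Sum>l<n. (1 - (r l)\<^sup>2) * (\<Sum>i<n. of_real (v $ i) * r l ^ i)\<^sup>2)"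
proof -
  have "v \<bullet> (map_mat Re (hermite_mat_D n z) *\<^sub>v v)
    = (\<Sum>i<n. \<Sum>j<n. v $ i * (Re (hermite_mat_D n z $$ (i, j)) * v $ j))"
    using v carrier_matD[OF hermite_mat_D_carrier[of n z]]
    by (simp add: scalar_prod_def atLeast0LessThan sum_distrib_left)
  also have "\<dots> = Re (\<Sum>i<n. \<Sum>j<n. of_real (v $ i) * of_real (v $ j) * hermite_mat_D n z $$ (i, j))"
    by (simp add: mult_ac)
  also have "(\<Sum>i<n. \<Sum>j<n. of_real (v $ i) * of_real (v $ j) * hermite_mat_D n z $$ (i, j))
    = (\<Sum>i<n. \<Sum>j<n. \<Sum>l<n. (1 - (r l)\<^sup>2) * ((of_real (v $ i) * r l ^ i) * (of_real (v $ j) * r l ^ j)))"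
    using hermite_mat_D_index[OF _ _ c] by (simp add: sum_distrib_left mult_ac)
  also have "\<dots> = (\<Sum>i<n. \<Sum>l<n. \<Sum>j<n. (1 - (r l)\<^sup>2) * ((of_real (v $ i) * r l ^ i) * (of_real (v $ j) * r l ^ j)))"
    by (rule sum.cong[OF refl], rule sum.swap)
  also have "\<dots> = (\<Sum>l<n. \<Sum>i<n. \<Sum>j<n. (1 - (r l)\<^sup>2) * ((of_real (v $ i) * r l ^ i) * (of_real (v $ j) * r l ^ j)))"
    by (rule sum.swap)
  also have "\<dots> = (\<Sum>l<n. (1 - (r l)\<^sup>2) * (\<Sum>i<n. of_real (v $ i) * r l ^ i)\<^sup>2)"
    by (simp only: power2_eq_square sum_product, simp only: sum_distrib_left)
  finally show ?thesis .
qed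

section \<open>Real matrices and real interpolation\<close>

lemma pow_mat_Reals:
  fixes A :: "complex mat"
  assumes A: "A \<in> carrier_mat n n" and real: "\<And>i j. i < n \<Longrightarrow> j < n \<Longrightarrow> A $$ (i, j) \<in> \<real>"
  shows "i < n \<Longrightarrow> j < n \<Longrightarrow> (A ^\<^sub>m k) $$ (i, j) \<in> \<real>"
proof (induction k arbitrary: i j)
  case 0
  thus ?case using A by auto
next
  case (Suc k)
  have Ak: "A ^\<^sub>m k \<in> carrier_mat n n" using A by simp
  show ?case using Suc.prems A carrier_matD[OF Ak]
    by (auto simp: scalar_prod_def intro!: sum_in_Reals Reals_mult Suc.IH real)
qed

text \<open>Serves to refute semidefiniteness if a root \<open>m\<close> lies outside [-1, 1]. The
  monic polynomial with roots \<open>R - {m, cnj m}\<close> is real, as this set is closed under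
  conjugation; only its value at \<open>m\<close> may need correction.\<close>

lemma interpolation_negative:
  fixes R :: "complex set"
  assumes fin: "finite R" and card: "card R \<le> n" and cnj: "\<And>\<mu>. \<mu> \<in> R \<Longrightarrow> cnj \<mu> \<in> R"
    and m: "m \<in> R" and outside: "\<not> (m \<in> \<real> \<and> \<bar>Re m\<bar> \<le> 1)"
  shows "\<exists>v :: nat \<Rightarrow> real. \<exists>a<0. \<forall>\<mu>\<in>R. (1 - \<mu>\<^sup>2) * (\<Sum>i<n. of_real (v i) * \<mu> ^ i)\<^sup>2
    = (if \<mu> = m \<or> \<mu> = cnj m then of_real a else 0)"
proof -
  define R' where "R' = R - {m, cnj m}"
  define p where "p = (\<Prod>\<mu>\<in>R'. [:- \<mu>, 1:])"
  have fin': "finite R'" using fin by (simp add: R'_def)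
  have deg_p: "degree p = card R'"
    unfolding p_def by (subst degree_prod_eq_sum_degree) auto
  have p_0: "poly p \<mu> = 0 \<longleftrightarrow> \<mu> \<in> R'" for \<mu>
    using fin' by (auto simp: p_def poly_prod)
  have poly_p_cnj: "poly p (cnj x) = cnj (poly p x)" for x
  proof -
    have "cnj ` R' = R'"
    proof
      show "cnj ` R' \<subseteq> R'" using cnj unfolding R'_def by auto
      thus "R' \<subseteq> cnj ` R'" by (metis complex_cnj_cnj image_subset_iff rev_image_eqI subsetI)
    qed
    hence "poly p (cnj x) = (\<Prod>\<mu>\<in>cnj ` R'. cnj x - \<mu>)" by (simp add: p_def poly_prod)
    also have "\<dots> = (\<Prod>\<mu>\<in>R'. cnj x - cnj \<mu>)" by (subst prod.reindex) (auto simp: inj_on_def)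
    finally show ?thesis by (simp add: p_def poly_prod)
  qed
  have nz: "poly p m \<noteq> 0" unfolding p_0 by (simp add: R'_def)
  have ex: "\<exists>q a. degree q < n \<and> (\<forall>x. poly q (cnj x) = cnj (poly q x)) \<and> p dvd q
      \<and> a < 0 \<and> (1 - m\<^sup>2) * (poly q m)\<^sup>2 = of_real a"
  proof (cases "m \<in> \<real>")
    case True
    then obtain x where x: "m = of_real x" by (auto elim: Reals_cases)
    have "poly p m \<in> \<real>" using poly_p_cnj[of m] True by (simp add: Reals_cnj_iff x)
    then obtain y where y: "poly p m = of_real y" by (auto elim: Reals_cases)
    \<comment> \<open>For real \<open>m\<close> the weight \<open>1 - m^2\<close> is already
      negative, and \<open>p\<close> itself serves as \<open>q\<close>.\<close>
    have "1 < x\<^sup>2" using outside x one_less_power[of "\<bar>x\<bar>" 2] by auto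
    moreover have "0 < y\<^sup>2" using nz y by simp
    ultimately have "(1 - x\<^sup>2) * y\<^sup>2 < 0" by (simp add: mult_neg_pos)
    moreover have "(1 - m\<^sup>2) * (poly p m)\<^sup>2 = of_real ((1 - x\<^sup>2) * y\<^sup>2)" using y by (simp add: x)
    moreover have "card R' < n"
      using psubset_card_mono[OF fin, of R'] m card unfolding R'_def by fastforce
    ultimately show ?thesis using deg_p poly_p_cnj by (metis dvd_refl)
  next
    case False
    hence im: "Im m \<noteq> 0" by (simp add: complex_is_Real_iff)
    have m2: "1 - m\<^sup>2 \<noteq> 0"
    proof
      assume "1 - m\<^sup>2 = 0"
      hence "m = 1 \<or> m = - 1" using power2_eq_1_iff[of m] by simp
      thus False using im by auto
    qed
    \<comment> \<open>As \<open>m\<close> is not real, 1 and \<open>m\<close> form a real basis of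
      the complex numbers, so a real linear factor can take any value at \<open>m\<close>. The value
      \<open>u\<close> makes the weighted square there equal to -1.\<close>
    define u where "u = csqrt (- 1 / (1 - m\<^sup>2)) / poly p m"
    define b where "b = Im u / Im m"
    define a where "a = Re u - b * Re m"
    have u: "of_real a + of_real b * m = u"
      using im by (simp add: complex_eq_iff a_def b_def)
    define q where "q = [:of_real a, of_real b:] * p"
    have "poly q m = csqrt (- 1 / (1 - m\<^sup>2))"
      unfolding q_def poly_mult using u nz by (simp add: mult.commute u_def)
    hence "(1 - m\<^sup>2) * (poly q m)\<^sup>2 = of_real (- 1)" using m2 by simp
    \<comment> \<open>The linear factor raises the degree by one, but two points of \<open>R\<close>
      are missing from \<open>R'\<close>.\<close>
    moreover have "degree q < n"
    proof -
      have "m \<noteq> cnj m" using im by (auto simp: complex_eq_iff)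
      moreover have "{m, cnj m} \<subseteq> R" using m cnj by auto
      ultimately have "card R' = card R - 2" "2 \<le> card R"
        using fin card_mono[OF fin, of "{m, cnj m}"] by (auto simp: R'_def card_Diff_subset)
      moreover have "degree q \<le> 1 + card R'"
        unfolding q_def deg_p[symmetric] by (rule order_trans[OF degree_mult_le]) simp
      ultimately show ?thesis using card by linarith
    qed
    moreover have "\<forall>x. poly q (cnj x) = cnj (poly q x)" by (simp add: q_def poly_p_cnj)
    moreover have "p dvd q" unfolding q_def by (rule dvd_triv_right)
    ultimately show ?thesis by (intro exI[of _ q] exI[of _ "- 1"]) simp
  qed
  then obtain q a where deg: "degree q < n" and q_cnj: "\<And>x. poly q (cnj x) = cnj (poly q x)"
    and dvd: "p dvd q" and a: "a < 0" "(1 - m\<^sup>2) * (poly q m)\<^sup>2 = of_real a" by blast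
  \<comment> \<open>Commuting with conjugation forces \<open>q\<close> to have real coefficients,
    which then form \<open>v\<close>.\<close>
  have "poly (map_poly cnj q) x = poly q x" for x
    using q_cnj[of "cnj x"] by (metis complex_cnj_cnj poly_cnj)
  hence "map_poly cnj q = q" by (simp add: poly_eq_poly_eq_iff[symmetric] fun_eq_iff)
  hence "cnj (coeff q i) = coeff q i" for i by (metis coeff_map_poly complex_cnj_zero)
  hence real: "of_real (Re (coeff q i)) = coeff q i" for i
    by (simp add: Reals_cnj_iff)
  have poly_q: "(\<Sum>i<n. of_real (Re (coeff q i)) * \<mu> ^ i) = poly q \<mu>" for \<mu>
    unfolding poly_altdef real using deg by (intro sum.mono_neutral_right) (auto simp: coeff_eq_0)
  have "(1 - \<mu>\<^sup>2) * (poly q \<mu>)\<^sup>2 = (if \<mu> = m \<or> \<mu> = cnj m then of_real a else 0)" if "\<mu> \<in> R" for \<mu>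
  proof -
    have "(1 - (cnj m)\<^sup>2) * (poly q (cnj m))\<^sup>2 = of_real a"
      unfolding q_cnj using arg_cong[OF a(2), of cnj] by simp
    moreover have "poly q \<mu> = 0" if "\<mu> \<noteq> m" "\<mu> \<noteq> cnj m"
      using dvd p_0[of \<mu>] \<open>\<mu> \<in> R\<close> that by (auto simp: R'_def elim!: dvdE)
    ultimately show ?thesis using a(2) by auto
  qed
  thus ?thesis using a(1) poly_q by (intro exI[of _ "\<lambda>i. Re (coeff q i)"]) auto
qed

section \<open>The coefficients of the characteristic polynomial\<close>

lemma sum_atMost_parity:
  fixes e :: "nat \<Rightarrow> 'a::comm_ring_1"
  shows "(\<Sum>i\<le>2 * m. e i) = e 0 + (\<Sum>j = 1..m. e (2 * j)) + (\<Sum>j = 1..m. e (2 * j - 1))"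
    and "(\<Sum>i\<le>2 * m. (- 1) ^ i * e i) = e 0 + (\<Sum>j = 1..m. e (2 * j)) - (\<Sum>j = 1..m. e (2 * j - 1))"
    and "(\<Sum>i\<le>2 * m + 1. e i) = e 0 + (\<Sum>j = 1..m. e (2 * j)) + (\<Sum>j = 0..m. e (2 * j + 1))"
    and "(\<Sum>i\<le>2 * m + 1. (- 1) ^ i * e i) = e 0 + (\<Sum>j = 1..m. e (2 * j)) - (\<Sum>j = 0..m. e (2 * j + 1))"
  by (induction m) (simp_all add: algebra_simps)

text \<open>The last two coefficients contain \<open>2 ^ (n - 2)\<close> times 2 z_n z_(n-1) and
  z_n^2 + z_(n-1)^2; their sum and difference are complete squares. For \<open>e\<close> from roots
  r_k, the right-hand sides are the products of the 1 + r_k and of the r_k - 1.\<close>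

lemma char_coeff_D_iff:
  fixes z :: "'a::field_char_0 vec"
  assumes n: "4 \<le> n" and e0: "e 0 = 1"
  shows "(\<forall>i\<in>{1..n}. char_coeff_D n z i = (- 1) ^ i * e i) \<longleftrightarrow>
    (\<forall>i\<in>{1..n - 2}. of_nat (n choose i) * z $\<^sub>1 i = e i) \<and>
    2 ^ (n - 2) * (z $\<^sub>1 n + z $\<^sub>1 (n - 1))\<^sup>2 = (\<Sum>i\<le>n. e i) \<and>
    2 ^ (n - 2) * (z $\<^sub>1 n - z $\<^sub>1 (n - 1))\<^sup>2 = (- 1) ^ n * (\<Sum>i\<le>n. (- 1) ^ i * e i)"
    (is "?L \<longleftrightarrow> ?low \<and> ?plus \<and> ?minus")
proof -
  have split: "{1..n} = {1..n - 2} \<union> {n - 1, n}" using n by auto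
  have low: "(\<forall>i\<in>{1..n - 2}. char_coeff_D n z i = (- 1) ^ i * e i) \<longleftrightarrow> ?low"
    by (intro ball_cong refl) (simp add: char_coeff_D_def mult.assoc)
  have two: "(2::'a) ^ (n - 1) = 2 * 2 ^ (n - 2)"
    unfolding power_Suc[symmetric] using n by (intro arg_cong2[where f = "(^)"]) auto
  define t where "t = (2::'a) ^ (n - 2)"
  define a where "a = z $\<^sub>1 n"
  define b where "b = z $\<^sub>1 (n - 1)"
  have cond: "\<not> n - 1 \<le> n - 2" "\<not> n \<le> n - 2" "n \<noteq> n - 1" using n by auto
  have high: "char_coeff_D n z (n - 1) = (- 1) ^ (n - 1) * e (n - 1) \<and> char_coeff_D n z n = (- 1) ^ n * e n
      \<longleftrightarrow> ?plus \<and> ?minus" if ?low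
  proof -
    \<comment> \<open>\<open>S0\<close> collects the lower \<open>e i\<close> with \<open>i\<close>
      of the parity of \<open>n\<close>, and \<open>S1\<close> the others; the alternating sum
      separates the two classes. The constant 1 in the coefficients is \<open>e 0\<close>, in
      \<open>S0\<close> for even \<open>n\<close> and in \<open>S1\<close> for odd
      \<open>n\<close>.\<close>
    obtain S1 S0 where S: "char_coeff_D n z (n - 1) = (- 1) ^ (n - 1) * (2 * t * a * b - S1)"
      "char_coeff_D n z n = (- 1) ^ n * (t * (a\<^sup>2 + b\<^sup>2) - S0)"
      "(\<Sum>i\<le>n. e i) = S0 + e n + (S1 + e (n - 1))"
      "(- 1) ^ n * (\<Sum>i\<le>n. (- 1) ^ i * e i) = S0 + e n - (S1 + e (n - 1))"
    proof (cases "even n")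
      case True
      then obtain m where "n = 2 * m" by (rule evenE)
      then obtain k where k: "n = 2 * (k + 1)" "1 \<le> k" using n by (cases m) auto
      have low': "of_nat (n choose i) * z $\<^sub>1 i = e i" if "1 \<le> i" "i \<le> 2 * k" for i
        using that \<open>?low\<close> k by auto
      have div: "(n - 2) div 2 = k" using k by simp
      have sums: "(\<Sum>j = 1..k. of_nat (n choose (2 * j - 1)) * z $\<^sub>1 (2 * j - 1)) = (\<Sum>j = 1..k. e (2 * j - 1))"
        "(\<Sum>j = 1..k. of_nat (n choose (2 * j)) * z $\<^sub>1 (2 * j)) = (\<Sum>j = 1..k. e (2 * j))"
        by (intro sum.cong refl low'; force)+
      have minus_one: "(- 1) ^ n = (1::'a)" using True by simp
      show ?thesis
      proof (rule that)
        show "char_coeff_D n z (n - 1) = (- 1) ^ (n - 1) * (2 * t * a * b - (\<Sum>j = 1..k. e (2 * j - 1)))"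
          using True cond unfolding char_coeff_D_def div t_def a_def b_def two
          by (simp only: sums if_True if_False simp_thms)
        show "char_coeff_D n z n = (- 1) ^ n * (t * (a\<^sup>2 + b\<^sup>2) - ((\<Sum>j = 1..k. e (2 * j)) + 1))"
          using True cond unfolding char_coeff_D_def div t_def a_def b_def
          by (simp only: sums if_True if_False simp_thms diff_diff_eq)
        show "(\<Sum>i\<le>n. e i) = ((\<Sum>j = 1..k. e (2 * j)) + 1) + e n + ((\<Sum>j = 1..k. e (2 * j - 1)) + e (n - 1))"
          unfolding k sum_atMost_parity by (simp add: e0)
        show "(- 1) ^ n * (\<Sum>i\<le>n. (- 1) ^ i * e i)
          = ((\<Sum>j = 1..k. e (2 * j)) + 1) + e n - ((\<Sum>j = 1..k. e (2 * j - 1)) + e (n - 1))"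
          unfolding minus_one unfolding k sum_atMost_parity by (simp add: e0 sum_negf)
      qed
    next
      case False
      then obtain m where "n = 2 * m + 1" by (rule oddE)
      then obtain k where k: "n = 2 * (k + 1) + 1" "1 \<le> k" using n by (cases m) auto
      have low': "of_nat (n choose i) * z $\<^sub>1 i = e i" if "1 \<le> i" "i \<le> 2 * k + 1" for i
        using that \<open>?low\<close> k by auto
      have div: "(n - 3) div 2 = k" using k by simp
      have sums: "(\<Sum>j = 1..k. of_nat (n choose (2 * j)) * z $\<^sub>1 (2 * j)) = (\<Sum>j = 1..k. e (2 * j))"
        "(\<Sum>j = 0..k. of_nat (n choose (2 * j + 1)) * z $\<^sub>1 (2 * j + 1)) = (\<Sum>j = 0..k. e (2 * j + 1))"
        by (intro sum.cong refl low'; force)+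
      have minus_one: "(- 1) ^ n = (- 1::'a)" using False by simp
      show ?thesis
      proof (rule that)
        show "char_coeff_D n z (n - 1) = (- 1) ^ (n - 1) * (2 * t * a * b - ((\<Sum>j = 1..k. e (2 * j)) + 1))"
          using False cond unfolding char_coeff_D_def div t_def a_def b_def two
          by (simp only: sums if_True if_False simp_thms diff_diff_eq)
        show "char_coeff_D n z n = (- 1) ^ n * (t * (a\<^sup>2 + b\<^sup>2) - (\<Sum>j = 0..k. e (2 * j + 1)))"
          using False cond unfolding char_coeff_D_def div t_def a_def b_def
          by (simp only: sums if_True if_False simp_thms)
        show "(\<Sum>i\<le>n. e i) = (\<Sum>j = 0..k. e (2 * j + 1)) + e n + (((\<Sum>j = 1..k. e (2 * j)) + 1) + e (n - 1))"
          unfolding k sum_atMost_parity by (simp add: e0)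
        show "(- 1) ^ n * (\<Sum>i\<le>n. (- 1) ^ i * e i)
          = (\<Sum>j = 0..k. e (2 * j + 1)) + e n - (((\<Sum>j = 1..k. e (2 * j)) + 1) + e (n - 1))"
          unfolding minus_one unfolding k sum_atMost_parity by (simp add: e0 sum_negf)
      qed
    qed
    have solve: "(2 * t * a * b - S1 = x \<and> t * (a\<^sup>2 + b\<^sup>2) - S0 = y) \<longleftrightarrow>
        (t * (a + b)\<^sup>2 = S0 + y + (S1 + x) \<and> t * (a - b)\<^sup>2 = S0 + y - (S1 + x))" for x y
    proof
      assume "t * (a + b)\<^sup>2 = S0 + y + (S1 + x) \<and> t * (a - b)\<^sup>2 = S0 + y - (S1 + x)"
      hence h: "t * (a + b)\<^sup>2 = S0 + y + (S1 + x)" "t * (a - b)\<^sup>2 = S0 + y - (S1 + x)" by auto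
      have "2 * (2 * t * a * b - S1) = t * (a + b)\<^sup>2 - t * (a - b)\<^sup>2 - 2 * S1"
        "2 * (t * (a\<^sup>2 + b\<^sup>2) - S0) = t * (a + b)\<^sup>2 + t * (a - b)\<^sup>2 - 2 * S0"
        by (simp_all add: algebra_simps power2_eq_square)
      hence "2 * (2 * t * a * b - S1) = 2 * x" "2 * (t * (a\<^sup>2 + b\<^sup>2) - S0) = 2 * y"
        unfolding h by simp_all
      thus "2 * t * a * b - S1 = x \<and> t * (a\<^sup>2 + b\<^sup>2) - S0 = y"
        by (simp only: mult_cancel_left) simp
    next
      assume "2 * t * a * b - S1 = x \<and> t * (a\<^sup>2 + b\<^sup>2) - S0 = y"
      thus "t * (a + b)\<^sup>2 = S0 + y + (S1 + x) \<and> t * (a - b)\<^sup>2 = S0 + y - (S1 + x)"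
        by (auto simp: algebra_simps power2_eq_square)
    qed
    have sq: "(- 1) ^ k * x = (- 1) ^ k * y \<longleftrightarrow> x = y" for k and x y :: 'a by simp
    show ?thesis unfolding S sq a_def[symmetric] b_def[symmetric] t_def[symmetric] solve ..
  qed
  have "?L \<longleftrightarrow> (\<forall>i\<in>{1..n - 2}. char_coeff_D n z i = (- 1) ^ i * e i) \<and>
      char_coeff_D n z (n - 1) = (- 1) ^ (n - 1) * e (n - 1) \<and> char_coeff_D n z n = (- 1) ^ n * e n"
    unfolding split by blast
  thus ?thesis unfolding low using high by blast
qed

section \<open>The orbit space\<close>

lemma torus_point_D_in_compact_torus:
  assumes "\<And>k. k < n \<Longrightarrow> cmod (s k) = 1"
  shows "torus_point_D n s \<in> compact_torus n"
  using assms by (auto simp: compact_torus_def torus_point_D_def prod_norm[symmetric] norm_power_int)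

lemma cnj_unit: "cmod z = 1 \<Longrightarrow> cnj z = inverse z"
  by (simp add: inverse_complex_def complex_eq_iff cmod_def)

text \<open>The squares of the \<open>s k\<close> are forced to be monomials \<open>y k\<close> in
  \<open>x\<close>. Any square roots reproduce all coordinates up to a common sign in the last two,
  which is absorbed in \<open>s 0\<close>.\<close>

lemma compact_torus_imp_torus_point_D:
  assumes n: "3 \<le> n" and x: "x \<in> compact_torus n"
  shows "\<exists>s. (\<forall>k<n. cmod (s k) = 1) \<and> x = torus_point_D n s"
proof -
  have norm: "cmod (x $ i) = 1" if "i < n" for i using x that by (auto simp: compact_torus_def)
  hence nz: "x $ i \<noteq> 0" if "i < n" for i using that by force
  \<comment> \<open>The cases express the basis vectors by weights, numbered from 1: epsilon_1 =
    omega_1, epsilon_k = omega_k - omega_(k-1), epsilon_(n-1) = omega_(n-1) + omega_n - omega_(n-2),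
    epsilon_n = omega_n - omega_(n-1).\<close>
  define y where "y k = (if k = 0 then x $ 0 else if k + 2 < n then x $ k / x $ (k - 1)
    else if k + 2 = n then x $ (n - 1) * x $ (n - 2) / x $ (n - 3) else x $ (n - 1) / x $ (n - 2))" for k
  have norm_y: "cmod (y k) = 1" if "k < n" for k
    using n that norm by (auto simp: y_def norm_divide norm_mult)
  have prod_y: "(\<Prod>k<Suc i. y k) = x $ i" if "i + 2 < n" for i
    using that
  proof (induction i)
    case (Suc i)
    thus ?case using nz[of i] by (simp add: y_def)
  qed (simp add: y_def)
  have "(\<Prod>k<n. y k) = (\<Prod>k<Suc (n - 3). y k) * y (n - 2) * y (n - 1)"
  proof -
    have "n = Suc (Suc (Suc (n - 3)))" "n - 2 = Suc (n - 3)" "n - 1 = Suc (Suc (n - 3))" using n by auto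
    thus ?thesis by (metis prod.lessThan_Suc)
  qed
  also have "\<dots> = (x $ (n - 1))\<^sup>2"
    using prod_y[of "n - 3"] n nz[of "n - 3"] nz[of "n - 2"]
    by (simp add: y_def power2_eq_square)
  finally have "(\<Prod>k<n. csqrt (y k))\<^sup>2 = (x $ (n - 1))\<^sup>2"
    by (simp add: prod_power_distrib)
  then obtain \<sigma> :: complex where \<sigma>: "\<sigma>\<^sup>2 = 1" "x $ (n - 1) = \<sigma> * (\<Prod>k<n. csqrt (y k))"
    using that[of 1] that[of "- 1"] by (auto simp: power2_eq_iff)
  define s where "s k = (if k = 0 then \<sigma> else 1) * csqrt (y k)" for k
  have s2: "(s k)\<^sup>2 = y k" for k using \<sigma>(1) by (simp add: s_def power_mult_distrib)
  have norm_s: "cmod (s k) = 1" if "k < n" for k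
    using arg_cong[OF s2[of k], of cmod] norm_y[OF that] by (simp add: norm_power power2_eq_1_iff) (smt (verit) norm_ge_zero)
  hence nz_s: "s k \<noteq> 0" if "k < n" for k using that by force
  have prod_s: "(\<Prod>k<n. s k) = x $ (n - 1)"
    unfolding s_def prod.distrib \<sigma>(2) using n by (simp add: prod.delta)
  have "x $ i = (\<Prod>k<n. s k powi weight2_D n k i)" if i: "i < n" for i
  proof -
    consider "i + 2 < n" | "i + 2 = n" | "i + 1 = n" using i by linarith
    thus ?thesis
    proof cases
      case 1
      have "(\<Prod>k<n. s k powi weight2_D n k i) = (\<Prod>k<n. if k < Suc i then y k else 1)"
        using 1 by (intro prod.cong) (auto simp: weight2_D_def s2)
      also have "\<dots> = (\<Prod>k<Suc i. y k)"
        using 1 by (intro prod.mono_neutral_cong_right) auto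
      finally show ?thesis using prod_y[OF 1] by simp
    next
      case 2
      \<comment> \<open>The minus sign in the last coordinate of omega_(n-1) divides the full
        product by the square of \<open>s (n - 1)\<close>.\<close>
      have "(\<Prod>k<n. s k powi weight2_D n k i) = (\<Prod>k<n. s k * (if k = n - 1 then inverse (y k) else 1))"
        using 2 nz_s by (intro prod.cong) (auto simp: weight2_D_def power_int_minus s2[symmetric] power2_eq_square)
      also have "\<dots> = x $ (n - 1) * inverse (y (n - 1))"
        using n by (simp add: prod.distrib prod_s prod.delta)
      also have "\<dots> = x $ i" using 2 n nz[of "n - 1"] by (auto simp: y_def)
      finally show ?thesis by simp
    next
      case 3
      hence "i = n - 1" by simp
      moreover have "(\<Prod>k<n. s k powi weight2_D n k i) = (\<Prod>k<n. s k)"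
        using 3 by (intro prod.cong) (auto simp: weight2_D_def)
      ultimately show ?thesis by (simp add: prod_s)
    qed
  qed
  hence "x = torus_point_D n s"
    using x by (intro eq_vecI) (auto simp: torus_point_D_def compact_torus_def)
  thus ?thesis using norm_s by blast
qed

section \<open>The orbit map, with cosines as roots\<close>

definition orbit_point_D :: "nat \<Rightarrow> complex vec \<Rightarrow> complex vec"
  where "orbit_point_D n x = vec n (\<lambda>k. orbit_poly_D n (k + 1) x)"

lemma torus_orbit_space_D_eq:
  assumes "3 \<le> n"
  shows "torus_orbit_space_D n =
    (\<lambda>s. orbit_point_D n (torus_point_D n s)) ` {s. \<forall>k<n. cmod (s k) = 1}"
  unfolding torus_orbit_space_D_def orbit_point_D_def[symmetric]
  using compact_torus_imp_torus_point_D[OF assms] torus_point_D_in_compact_torus by fastforce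

lemma orbit_point_D_index: "1 \<le> i \<Longrightarrow> i \<le> n \<Longrightarrow> orbit_point_D n x $\<^sub>1 i = orbit_poly_D n i x"
  by (cases i) (auto simp: orbit_point_D_def)

lemma orbit_point_D_last:
  assumes n: "3 \<le> n" and s: "\<forall>k<n. s k \<noteq> 0"
  defines "t \<equiv> orbit_point_D n (torus_point_D n s)"
  shows "2 ^ (n - 1) * (t $\<^sub>1 n + t $\<^sub>1 (n - 1)) = (\<Prod>k<n. s k + inverse (s k))"
    and "2 ^ (n - 1) * (t $\<^sub>1 n - t $\<^sub>1 (n - 1)) = (\<Prod>k<n. s k - inverse (s k))"
proof -
  have t: "t $\<^sub>1 n = orbit_poly_D n n (torus_point_D n s)"
    "t $\<^sub>1 (n - 1) = orbit_poly_D n (n - 1) (torus_point_D n s)"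
    unfolding t_def using n by (intro orbit_point_D_index; simp)+
  have two: "(2::complex) ^ n = 2 * 2 ^ (n - 1)" using n by (cases n) auto
  have "2 * (2 ^ (n - 1) * (t $\<^sub>1 n + t $\<^sub>1 (n - 1))) = 2 * (\<Prod>k<n. s k + inverse (s k))"
    using orbit_poly_D_spin[OF n s] unfolding t two by (simp add: algebra_simps)
  thus "2 ^ (n - 1) * (t $\<^sub>1 n + t $\<^sub>1 (n - 1)) = (\<Prod>k<n. s k + inverse (s k))"
    unfolding mult_cancel_left by simp
  have "2 * (2 ^ (n - 1) * (t $\<^sub>1 n - t $\<^sub>1 (n - 1))) = 2 * (\<Prod>k<n. s k - inverse (s k))"
    using orbit_poly_D_spin[OF n s] unfolding t two by (simp add: algebra_simps)
  thus "2 ^ (n - 1) * (t $\<^sub>1 n - t $\<^sub>1 (n - 1)) = (\<Prod>k<n. s k - inverse (s k))"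
    unfolding mult_cancel_left by simp
qed

text \<open>The identities (s + 1/s)^2 = 2 (c + 1) and (s - 1/s)^2 = -2 (1 - c) turn the squared
  products into the two values required by \<open>char_coeff_D_iff\<close>.\<close>

lemma char_coeff_orbit_point_D:
  assumes n: "4 \<le> n" and s: "\<forall>k<n. s k \<noteq> 0" and i: "i \<in> {1..n}"
  shows "char_coeff_D n (orbit_point_D n (torus_point_D n s)) i =
    (- 1) ^ i * esym n i (\<lambda>k. ((s k)\<^sup>2 + inverse ((s k)\<^sup>2)) / 2)" (is "char_coeff_D n ?t i = _ * esym n i ?c")
proof -
  have n3: "3 \<le> n" using n by simp
  have four: "(2 ^ (n - 1))\<^sup>2 = (2 ^ n * 2 ^ (n - 2) :: complex)"
    unfolding power2_eq_square power_add[symmetric] using n by (intro arg_cong2[where f = "(^)"]) auto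
  have low: "\<forall>i\<in>{1..n - 2}. of_nat (n choose i) * ?t $\<^sub>1 i = esym n i ?c"
  proof
    fix i assume i: "i \<in> {1..n - 2}"
    hence "?t $\<^sub>1 i = orbit_poly_D n i (torus_point_D n s)" by (intro orbit_point_D_index) auto
    thus "of_nat (n choose i) * ?t $\<^sub>1 i = esym n i ?c"
      using orbit_poly_D_esym[OF n3 s] i by simp
  qed
  have "2 ^ n * (2 ^ (n - 2) * (?t $\<^sub>1 n + ?t $\<^sub>1 (n - 1))\<^sup>2) = (2 ^ (n - 1) * (?t $\<^sub>1 n + ?t $\<^sub>1 (n - 1)))\<^sup>2"
    unfolding power_mult_distrib four by (simp only: mult.assoc)
  also have "\<dots> = (\<Prod>k<n. 2 * (?c k + 1))"
    unfolding orbit_point_D_last[OF n3 s] prod_power_distrib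
    using s by (intro prod.cong refl) (simp add: power2_eq_square field_simps)
  also have "\<dots> = 2 ^ n * (\<Sum>i\<le>n. esym n i ?c)"
    unfolding prod.distrib prod_add_const_esym by simp
  finally have plus: "2 ^ (n - 2) * (?t $\<^sub>1 n + ?t $\<^sub>1 (n - 1))\<^sup>2 = (\<Sum>i\<le>n. esym n i ?c)"
    unfolding mult_cancel_left by simp
  have "2 ^ n * (2 ^ (n - 2) * (?t $\<^sub>1 n - ?t $\<^sub>1 (n - 1))\<^sup>2) = (2 ^ (n - 1) * (?t $\<^sub>1 n - ?t $\<^sub>1 (n - 1)))\<^sup>2"
    unfolding power_mult_distrib four by (simp only: mult.assoc)
  also have "\<dots> = (\<Prod>k<n. 2 * (- 1 * (1 - ?c k)))"
    unfolding orbit_point_D_last[OF n3 s] prod_power_distrib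
    using s by (intro prod.cong refl) (simp add: power2_eq_square field_simps)
  also have "\<dots> = 2 ^ n * ((- 1) ^ n * (\<Sum>i\<le>n. (- 1) ^ i * esym n i ?c))"
    unfolding prod.distrib prod_diff_const_esym by simp
  finally have minus: "2 ^ (n - 2) * (?t $\<^sub>1 n - ?t $\<^sub>1 (n - 1))\<^sup>2 =
      (- 1) ^ n * (\<Sum>i\<le>n. (- 1) ^ i * esym n i ?c)"
    unfolding mult_cancel_left by simp
  show ?thesis
    using char_coeff_D_iff[OF n, of "\<lambda>i. esym n i ?c" ?t] low plus minus i by simp
qed

text \<open>Conjugation inverts each \<open>s k\<close>, so it fixes \<open>A\<close> and multiplies
  \<open>B\<close> by \<open>(- 1) ^ n\<close>. Hence the last two coordinates are real for even
  \<open>n\<close> and exchanged by conjugation for odd \<open>n\<close>.\<close>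

lemma orbit_point_D_in_ambient_D:
  assumes n: "4 \<le> n" and s: "\<And>k. k < n \<Longrightarrow> cmod (s k) = 1"
  shows "orbit_point_D n (torus_point_D n s) \<in> ambient_D n" (is "?t \<in> _")
proof -
  have n3: "3 \<le> n" using n by simp
  have nz: "\<forall>k<n. s k \<noteq> 0" using s by force
  let ?c = "\<lambda>k. ((s k)\<^sup>2 + inverse ((s k)\<^sup>2)) / 2"
  have cnj_c: "cnj (?c k) = ?c k" if "k < n" for k
    using cnj_unit[OF s[OF that]] by (simp add: power_inverse add.commute)
  have low: "?t $\<^sub>1 i \<in> \<real>" if i: "i \<in> {1..n - 2}" for i
  proof -
    have "?t $\<^sub>1 i = orbit_poly_D n i (torus_point_D n s)" using i by (intro orbit_point_D_index) auto
    hence eq: "of_nat (n choose i) * ?t $\<^sub>1 i = esym n i ?c"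
      using orbit_poly_D_esym[OF n3 nz] i by simp
    have "esym n i ?c \<in> \<real>"
      unfolding esym_def using cnj_c by (intro sum_in_Reals prod_in_Reals) (auto simp: Reals_cnj_iff)
    moreover have "i \<le> n" using i by auto
    hence "of_nat (n choose i) \<noteq> (0::complex)" by simp
    hence "?t $\<^sub>1 i = esym n i ?c / of_nat (n choose i)"
      unfolding eq[symmetric] by (rule nonzero_mult_div_cancel_left[symmetric])
    ultimately show ?thesis by simp
  qed
  define A where "A = (\<Prod>k<n. s k + inverse (s k))"
  define B where "B = (\<Prod>k<n. s k - inverse (s k))"
  have "cnj A = A"
    unfolding A_def cnj_prod by (intro prod.cong) (auto simp: cnj_unit[OF s])
  have "cnj B = (\<Prod>k<n. - 1 * (s k - inverse (s k)))"
    unfolding B_def cnj_prod by (intro prod.cong) (auto simp: cnj_unit[OF s])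
  hence "cnj B = (- 1) ^ n * B" unfolding prod.distrib B_def by simp
  note last = orbit_point_D_last[OF n3 nz, folded A_def B_def]
  have "2 * 2 ^ (n - 1) * ?t $\<^sub>1 n = A + B" "2 * 2 ^ (n - 1) * ?t $\<^sub>1 (n - 1) = A - B"
    unfolding last[symmetric] by (simp_all add: algebra_simps)
  hence t: "?t $\<^sub>1 n = (A + B) / (2 * 2 ^ (n - 1))" "?t $\<^sub>1 (n - 1) = (A - B) / (2 * 2 ^ (n - 1))"
    by (simp_all add: field_simps)
  have cnj_t: "cnj (?t $\<^sub>1 n) = (if even n then ?t $\<^sub>1 n else ?t $\<^sub>1 (n - 1))"
    "even n \<Longrightarrow> cnj (?t $\<^sub>1 (n - 1)) = ?t $\<^sub>1 (n - 1)"
    unfolding t using \<open>cnj A = A\<close> \<open>cnj B = (- 1) ^ n * B\<close> by auto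
  have dim: "?t \<in> carrier_vec n" by (simp add: orbit_point_D_def)
  show ?thesis
  proof (cases "even n")
    case True
    have "?t $\<^sub>1 i \<in> \<real>" if "i \<in> {1..n}" for i
    proof -
      have "i \<in> {1..n - 2} \<or> i = n - 1 \<or> i = n" using that by auto
      thus ?thesis using low cnj_t True by (elim disjE) (auto simp: Reals_cnj_iff)
    qed
    thus ?thesis using True dim by (auto simp: ambient_D_def)
  next
    case False
    thus ?thesis using dim low cnj_t by (auto simp: ambient_D_def)
  qed
qed

text \<open>The last two coordinates enter only through their product and their sum of squares,
  which are real for two real numbers as well as for a conjugate pair.\<close>

lemma char_coeff_D_Reals:
  assumes n: "4 \<le> n" and z: "z \<in> ambient_D n" and i: "1 \<le> i" "i \<le> n"
  shows "char_coeff_D n z i \<in> \<real>"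
proof -
  have low: "z $\<^sub>1 j \<in> \<real>" if "1 \<le> j" "j \<le> n - 2" for j
    using z that by (auto simp: ambient_D_def split: if_splits)
  have high: "z $\<^sub>1 n * z $\<^sub>1 (n - 1) \<in> \<real> \<and> (z $\<^sub>1 n)\<^sup>2 + (z $\<^sub>1 (n - 1))\<^sup>2 \<in> \<real>"
  proof (cases "even n")
    case True
    hence "\<forall>i\<in>{1..n}. z $\<^sub>1 i \<in> \<real>" using z by (simp add: ambient_D_def)
    from bspec[OF this, of n] bspec[OF this, of "n - 1"]
    have "z $\<^sub>1 n \<in> \<real>" "z $\<^sub>1 (n - 1) \<in> \<real>" using n by simp_all
    thus ?thesis by (intro conjI Reals_add Reals_mult Reals_power)
  next
    case False
    hence "z $\<^sub>1 (n - 1) = cnj (z $\<^sub>1 n)" using z by (simp add: ambient_D_def)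
    thus ?thesis by (simp add: Reals_cnj_iff mult.commute add.commute)
  qed
  define X where "X = 2 ^ (n - 1) * z $\<^sub>1 n * z $\<^sub>1 (n - 1)"
  define Y where "Y = 2 ^ (n - 2) * ((z $\<^sub>1 n)\<^sup>2 + (z $\<^sub>1 (n - 1))\<^sup>2)"
  have "X \<in> \<real>" unfolding X_def mult.assoc using high by (intro Reals_mult[of "2 ^ (n - 1)"]) auto
  moreover have "Y \<in> \<real>" unfolding Y_def using high by (intro Reals_mult[of "2 ^ (n - 2)"]) auto
  moreover have "z $\<^sub>1 (2 * j - 1) \<in> \<real>" if "j \<in> {1..(n - 2) div 2}" for j
    by (rule low) (use that in auto)
  moreover have "z $\<^sub>1 (2 * j) \<in> \<real>" if "j \<in> {1..(n - 2) div 2}" for j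
    by (rule low) (use that in auto)
  moreover have "z $\<^sub>1 (2 * j) \<in> \<real>" if "j \<in> {1..(n - 3) div 2}" for j
    by (rule low) (use that in auto)
  moreover have "z $\<^sub>1 (2 * j + 1) \<in> \<real>" if "j \<in> {0..(n - 3) div 2}" "odd n" for j
    by (rule low) (use that n in \<open>auto elim!: oddE\<close>)
  ultimately show ?thesis
    using i low[of i] unfolding char_coeff_D_def X_def[symmetric] Y_def[symmetric]
    by (auto simp del: One_nat_def intro!: Reals_mult Reals_diff Reals_minus Reals_power sum_in_Reals)
qed

lemma hermite_mat_D_Reals:
  assumes n: "4 \<le> n" and z: "z \<in> ambient_D n"
  shows "elements_mat (hermite_mat_D n z) \<subseteq> \<real>"
proof
  fix a assume "a \<in> elements_mat (hermite_mat_D n z)"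
  then obtain i j where ij: "i < n" "j < n" and a: "a = hermite_mat_D n z $$ (i, j)"
    by (auto simp: hermite_mat_D_def)
  let ?C = "companion_D n z"
  have Ck: "?C ^\<^sub>m k \<in> carrier_mat n n" for k by simp
  have "?C $$ (i, j) \<in> \<real>" if "i < n" "j < n" for i j
    using that char_coeff_D_Reals[OF n z, of "n - i"] by (simp add: companion_D_def)
  hence "(?C ^\<^sub>m k) $$ (i, i) \<in> \<real>" if "i < n" for i k
    using pow_mat_Reals[OF companion_D_carrier] that by blast
  hence "mat_trace (?C ^\<^sub>m k) \<in> \<real>" for k
    unfolding mat_trace_def carrier_matD[OF Ck] by (intro sum_in_Reals) auto
  moreover have "a = mat_trace (?C ^\<^sub>m (i + j)) - mat_trace (?C ^\<^sub>m (i + j + 2))"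
    using ij mat_trace_minus[OF Ck Ck] by (simp add: a hermite_mat_D_def del: pow_mat.simps add_2_eq_Suc')
  ultimately show "a \<in> \<real>" by (simp only: Reals_diff)
qed

section \<open>Semidefiniteness and the location of the roots\<close>

lemma psd_hermite_mat_D:
  fixes z :: "complex vec"
  assumes c: "\<forall>i\<in>{1..n}. char_coeff_D n z i = (- 1) ^ i * esym n i (\<lambda>k. of_real (r k))"
    and r: "\<And>k. k < n \<Longrightarrow> \<bar>r k\<bar> \<le> 1"
  shows "psd_mat (map_mat Re (hermite_mat_D n z))"
proof -
  let ?H = "hermite_mat_D n z"
  have dim: "dim_row ?H = n" "dim_col ?H = n" using carrier_matD[OF hermite_mat_D_carrier[of n z]] by auto
  have "transpose_mat (map_mat Re ?H) = map_mat Re ?H"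
    using dim hermite_mat_D_index[OF _ _ c] by (intro eq_matI) (auto simp: mult_ac)
  moreover have "0 \<le> v \<bullet> (map_mat Re ?H *\<^sub>v v)" if v: "v \<in> carrier_vec n" for v
  proof -
    have "v \<bullet> (map_mat Re ?H *\<^sub>v v) = (\<Sum>k<n. (1 - (r k)\<^sup>2) * (\<Sum>i<n. v $ i * r k ^ i)\<^sup>2)"
    proof -
      have "(\<Sum>k<n. (1 - (complex_of_real (r k))\<^sup>2) * (\<Sum>i<n. of_real (v $ i) * of_real (r k) ^ i)\<^sup>2)
        = of_real (\<Sum>k<n. (1 - (r k)\<^sup>2) * (\<Sum>i<n. v $ i * r k ^ i)\<^sup>2)" by simp
      thus ?thesis unfolding hermite_quadratic_form[OF c v] by (simp only: Re_complex_of_real)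
    qed
    also have "\<dots> \<ge> 0"
      using r by (intro sum_nonneg mult_nonneg_nonneg) (auto simp: abs_square_le_1)
    finally show ?thesis .
  qed
  ultimately show ?thesis using dim by (simp add: psd_mat_def)
qed

text \<open>Real coefficients make the set of roots closed under conjugation, so a root outside
  [-1, 1] yields a vector with negative value by interpolation.\<close>

lemma psd_hermite_mat_D_imp_roots_real:
  fixes z :: "complex vec"
  assumes c: "\<forall>i\<in>{1..n}. char_coeff_D n z i = (- 1) ^ i * esym n i r"
    and real: "\<And>i. i \<in> {1..n} \<Longrightarrow> char_coeff_D n z i \<in> \<real>"
    and psd: "psd_mat (map_mat Re (hermite_mat_D n z))" and m: "m < n"
  shows "r m \<in> \<real> \<and> \<bar>Re (r m)\<bar> \<le> 1"
proof (rule ccontr)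
  assume outside: "\<not> (r m \<in> \<real> \<and> \<bar>Re (r m)\<bar> \<le> 1)"
  let ?R = "r ` {..<n}"
  define p where "p = (\<Prod>l<n. [:- r l, 1:])"
  have p: "p = char_poly (companion_D n z)"
    unfolding p_def using c m by (subst eq_commute, subst char_poly_companion_D_eq_iff) auto
  have root: "poly p x = 0 \<longleftrightarrow> x \<in> ?R" for x by (auto simp: p_def poly_prod)
  have poly_p: "poly p x = x ^ n + (\<Sum>i\<in>{1..n}. char_coeff_D n z i * x ^ (n - i))" for x
    using m unfolding p by (subst char_poly_companion_D) (auto simp: poly_sum poly_monom)
  have "cnj (char_coeff_D n z i) = char_coeff_D n z i" if "i \<in> {1..n}" for i
    using real[OF that] by (simp add: Reals_cnj_iff)
  hence "poly p (cnj x) = cnj (poly p x)" for x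
    unfolding poly_p by (simp add: cnj_sum)
  hence cnj_R: "cnj \<mu> \<in> ?R" if "\<mu> \<in> ?R" for \<mu> using that by (simp flip: root)
  obtain v a where a: "a < 0" and v: "\<And>\<mu>. \<mu> \<in> ?R \<Longrightarrow>
      (1 - \<mu>\<^sup>2) * (\<Sum>i<n. of_real (v i) * \<mu> ^ i)\<^sup>2 = (if \<mu> = r m \<or> \<mu> = cnj (r m) then of_real a else 0)"
    using interpolation_negative[of ?R n "r m"] cnj_R outside m card_image_le[of "{..<n}" r] by auto
  define w where "w = vec n v"
  have w: "w \<in> carrier_vec n" by (simp add: w_def)
  have "w \<bullet> (map_mat Re (hermite_mat_D n z) *\<^sub>v w)
    = Re (\<Sum>l<n. (1 - (r l)\<^sup>2) * (\<Sum>i<n. of_real (v i) * r l ^ i)\<^sup>2)"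
    unfolding hermite_quadratic_form[OF c w] by (simp add: w_def)
  \<comment> \<open>Interpolation is on distinct roots, while this sum counts multiplicity: each
    index whose root is \<open>r m\<close> or its conjugate adds \<open>a < 0\<close>, and the index
    \<open>m\<close> is one of them.\<close>
  also have "\<dots> = (\<Sum>l<n. if r l = r m \<or> r l = cnj (r m) then a else 0)"
    unfolding Re_sum by (intro sum.cong refl) (simp add: v)
  also have "\<dots> < (\<Sum>l<n. 0)"
    using a m by (intro sum_strict_mono_ex1) auto
  finally show False
    using psd w carrier_matD[OF hermite_mat_D_carrier[of n z]] by (auto simp: psd_mat_def simp flip: not_le)
qed

text \<open>Passing from \<open>s 0\<close> to its negative flips both products, to its inverse only
  that of differences, to its negative inverse only that of sums.\<close>

lemma exists_sign_change:
  fixes s :: "nat \<Rightarrow> complex"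
  assumes n: "0 < n" and s: "\<forall>k<n. cmod (s k) = 1" and \<sigma>: "\<sigma>\<^sup>2 = 1" and \<tau>: "\<tau>\<^sup>2 = 1"
  shows "\<exists>s'. (\<forall>k<n. cmod (s' k) = 1) \<and> (\<forall>k. (s' k)\<^sup>2 + inverse ((s' k)\<^sup>2) = (s k)\<^sup>2 + inverse ((s k)\<^sup>2))
    \<and> (\<Prod>k<n. s' k + inverse (s' k)) = \<sigma> * (\<Prod>k<n. s k + inverse (s k))
    \<and> (\<Prod>k<n. s' k - inverse (s' k)) = \<tau> * (\<Prod>k<n. s k - inverse (s k))"
proof -
  have \<sigma>\<tau>: "\<sigma> = 1 \<or> \<sigma> = - 1" "\<tau> = 1 \<or> \<tau> = - 1" using \<sigma> \<tau> by (simp_all add: power2_eq_1_iff)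
  define s' where "s' k = (if k = 0 then \<sigma> * (if \<sigma> = \<tau> then s 0 else inverse (s 0)) else s k)" for k
  have "cmod (s' k) = 1" if "k < n" for k
    using s n that \<sigma>\<tau>(1) by (auto simp: s'_def norm_mult norm_inverse)
  moreover have "(s' k)\<^sup>2 + inverse ((s' k)\<^sup>2) = (s k)\<^sup>2 + inverse ((s k)\<^sup>2)" for k
    using \<sigma> by (auto simp: s'_def power_mult_distrib power_inverse)
  moreover have "(\<Prod>k<n. s' k + inverse (s' k)) = (\<Prod>k<n. (if k = 0 then \<sigma> else 1) * (s k + inverse (s k)))"
    using \<sigma>\<tau> by (intro prod.cong refl) (auto simp: s'_def)
  moreover have "(\<Prod>k<n. s' k - inverse (s' k)) = (\<Prod>k<n. (if k = 0 then \<tau> else 1) * (s k - inverse (s k)))"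
    using \<sigma>\<tau> by (intro prod.cong refl) (auto simp: s'_def)
  ultimately show ?thesis using n unfolding prod.distrib by (intro exI[of _ s']) (simp add: prod.delta)
qed

lemma psd_imp_in_orbit_space_D:
  assumes n: "4 \<le> n" and z: "z \<in> ambient_D n" and psd: "psd_mat (map_mat Re (hermite_mat_D n z))"
  shows "z \<in> torus_orbit_space_D n"
proof -
  have n3: "3 \<le> n" using n by simp
  obtain r where c: "\<forall>i\<in>{1..n}. char_coeff_D n z i = (- 1) ^ i * esym n i r"
    using exists_char_roots_D[of n z] n by auto
  have r: "r k \<in> \<real> \<and> \<bar>Re (r k)\<bar> \<le> 1" if "k < n" for k
    using psd_hermite_mat_D_imp_roots_real[OF c _ psd that] char_coeff_D_Reals[OF n z] by auto
  \<comment> \<open>The half angle makes the square of \<open>s k\<close> a point of the unit circle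
    with real part \<open>r k\<close>.\<close>
  define s where "s k = cis (arccos (Re (r k)) / 2)" for k
  have s_norm: "\<forall>k<n. cmod (s k) = 1" by (simp add: s_def)
  have s_c: "((s k)\<^sup>2 + inverse ((s k)\<^sup>2)) / 2 = r k" if "k < n" for k
  proof -
    have s2: "(s k)\<^sup>2 = cis (arccos (Re (r k)))" by (simp add: s_def power2_eq_square cis_mult)
    have "Im (r k) = 0" using r[OF that] by (simp add: complex_is_Real_iff)
    thus ?thesis unfolding s2 using r[OF that] by (simp add: complex_eq_iff cos_arccos_abs)
  qed
  have esym_eq: "esym n i f = esym n i r" if "\<And>k. k < n \<Longrightarrow> f k = r k" for i f
    unfolding esym_def using that by (intro sum.cong prod.cong) auto
  let ?t = "\<lambda>s. orbit_point_D n (torus_point_D n s)"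
  \<comment> \<open>The system of \<open>char_coeff_D_iff\<close> for the fixed roots. Both
    \<open>z\<close> and every orbit point with these cosines solve it, so they agree up to signs of
    the sum and the difference of the last two coordinates.\<close>
  let ?P = "\<lambda>y. (\<forall>i\<in>{1..n - 2}. of_nat (n choose i) * y $\<^sub>1 i = esym n i r) \<and>
    2 ^ (n - 2) * (y $\<^sub>1 n + y $\<^sub>1 (n - 1))\<^sup>2 = (\<Sum>i\<le>n. esym n i r) \<and>
    2 ^ (n - 2) * (y $\<^sub>1 n - y $\<^sub>1 (n - 1))\<^sup>2 = (- 1) ^ n * (\<Sum>i\<le>n. (- 1) ^ i * esym n i r)"
  have Pz: "?P z" using c unfolding char_coeff_D_iff[where e = "\<lambda>i. esym n i r", OF n esym_0] .
  have Pt: "?P (?t s)" if s: "\<forall>k<n. cmod (s k) = 1" "\<And>k. k < n \<Longrightarrow> ((s k)\<^sup>2 + inverse ((s k)\<^sup>2)) / 2 = r k" for s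
  proof -
    have nz: "\<forall>k<n. s k \<noteq> 0" using s(1) by force
    have esym: "esym n i (\<lambda>k. ((s k)\<^sup>2 + inverse ((s k)\<^sup>2)) / 2) = esym n i r" for i
      by (rule esym_eq) (rule s(2))
    have "\<forall>i\<in>{1..n}. char_coeff_D n (?t s) i = (- 1) ^ i * esym n i r"
      unfolding esym[symmetric] using char_coeff_orbit_point_D[OF n nz] by blast
    thus ?thesis unfolding char_coeff_D_iff[where e = "\<lambda>i. esym n i r", OF n esym_0] .
  qed
  note Ps = Pt[OF s_norm s_c]
  have "2 ^ (n - 2) * (z $\<^sub>1 n + z $\<^sub>1 (n - 1))\<^sup>2 = 2 ^ (n - 2) * (?t s $\<^sub>1 n + ?t s $\<^sub>1 (n - 1))\<^sup>2"
    "2 ^ (n - 2) * (z $\<^sub>1 n - z $\<^sub>1 (n - 1))\<^sup>2 = 2 ^ (n - 2) * (?t s $\<^sub>1 n - ?t s $\<^sub>1 (n - 1))\<^sup>2"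
    by (simp_all only: Pz Ps)
  hence squares: "(z $\<^sub>1 n + z $\<^sub>1 (n - 1))\<^sup>2 = (?t s $\<^sub>1 n + ?t s $\<^sub>1 (n - 1))\<^sup>2"
    "(z $\<^sub>1 n - z $\<^sub>1 (n - 1))\<^sup>2 = (?t s $\<^sub>1 n - ?t s $\<^sub>1 (n - 1))\<^sup>2"
    unfolding mult_cancel_left by simp_all
  have sign: "\<exists>\<sigma>. \<sigma>\<^sup>2 = 1 \<and> x = \<sigma> * y" if "x\<^sup>2 = y\<^sup>2" for x y :: complex
    using that unfolding power2_eq_iff by (elim disjE) (rule exI[of _ 1], simp, rule exI[of _ "- 1"], simp)
  from sign[OF squares(1)] sign[OF squares(2)] obtain \<sigma> \<tau> :: complex where \<sigma>\<tau>: "\<sigma>\<^sup>2 = 1" "\<tau>\<^sup>2 = 1"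
    and z_last: "z $\<^sub>1 n + z $\<^sub>1 (n - 1) = \<sigma> * (?t s $\<^sub>1 n + ?t s $\<^sub>1 (n - 1))"
      "z $\<^sub>1 n - z $\<^sub>1 (n - 1) = \<tau> * (?t s $\<^sub>1 n - ?t s $\<^sub>1 (n - 1))"
    by blast
  obtain s' where s'_norm: "\<forall>k<n. cmod (s' k) = 1"
    and s'_c: "\<forall>k. (s' k)\<^sup>2 + inverse ((s' k)\<^sup>2) = (s k)\<^sup>2 + inverse ((s k)\<^sup>2)"
    and s'_prod: "(\<Prod>k<n. s' k + inverse (s' k)) = \<sigma> * (\<Prod>k<n. s k + inverse (s k))"
      "(\<Prod>k<n. s' k - inverse (s' k)) = \<tau> * (\<Prod>k<n. s k - inverse (s k))"
    using exists_sign_change[OF _ s_norm \<sigma>\<tau>] n by auto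
  have nz: "\<forall>k<n. s k \<noteq> 0" "\<forall>k<n. s' k \<noteq> 0" using s_norm s'_norm by force+
  have "2 ^ (n - 1) * (z $\<^sub>1 n + z $\<^sub>1 (n - 1)) = 2 ^ (n - 1) * (?t s' $\<^sub>1 n + ?t s' $\<^sub>1 (n - 1))"
    "2 ^ (n - 1) * (z $\<^sub>1 n - z $\<^sub>1 (n - 1)) = 2 ^ (n - 1) * (?t s' $\<^sub>1 n - ?t s' $\<^sub>1 (n - 1))"
    unfolding orbit_point_D_last[OF n3 nz(2)] s'_prod orbit_point_D_last[OF n3 nz(1), symmetric] z_last
    by (simp_all only: mult.left_commute)
  hence sum_diff: "z $\<^sub>1 n + z $\<^sub>1 (n - 1) = ?t s' $\<^sub>1 n + ?t s' $\<^sub>1 (n - 1)"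
    "z $\<^sub>1 n - z $\<^sub>1 (n - 1) = ?t s' $\<^sub>1 n - ?t s' $\<^sub>1 (n - 1)"
    unfolding mult_cancel_left by simp_all
  have halves: "a = a' \<and> b = b'" if "a + b = a' + b'" "a - b = a' - b'" for a b a' b' :: complex
  proof -
    have "2 * a = 2 * a'" using arg_cong2[OF that, of "(+)"] by simp
    thus ?thesis using that by simp
  qed
  note last = halves[OF sum_diff]
  have low: "z $\<^sub>1 i = ?t s' $\<^sub>1 i" if i: "i \<in> {1..n - 2}" for i
  proof -
    have "?P (?t s')" by (rule Pt[OF s'_norm]) (simp only: s'_c s_c)
    hence "of_nat (n choose i) * z $\<^sub>1 i = of_nat (n choose i) * ?t s' $\<^sub>1 i"
      using Pz i by (blast intro: trans sym)
    moreover have "i \<le> n" using i by auto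
    hence "of_nat (n choose i) \<noteq> (0::complex)" by simp
    ultimately show ?thesis by (simp only: mult_cancel_left) simp
  qed
  have "z = ?t s'"
  proof (rule eq_vecI)
    fix i assume "i < dim_vec (?t s')"
    hence i: "i < n" by (simp add: orbit_point_D_def)
    \<comment> \<open>Counted from 0, the positions \<open>n - 2\<close> and \<open>n - 1\<close>
      hold z_(n-1) and z_n, which come from \<open>last\<close>; all others come from
      \<open>low\<close>.\<close>
    hence "i + 1 \<in> {1..n - 2} \<or> i = n - 1 - 1 \<or> i = n - 1" using n by auto
    thus "z $ i = ?t s' $ i" using low[of "i + 1"] last by (elim disjE) auto
  next
    show "dim_vec z = dim_vec (?t s')"
      using z by (auto simp: ambient_D_def orbit_point_D_def split: if_splits)
  qed
  thus ?thesis unfolding torus_orbit_space_D_eq[OF n3] using s'_norm by blast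
qed

theorem theorem7p4:
  fixes n :: nat
  assumes "n \<ge> 4"
  shows "(\<forall>z \<in> ambient_D n. elements_mat (hermite_mat_D n z) \<subseteq> \<real>) \<and>
    torus_orbit_space_D n = {z \<in> ambient_D n. psd_mat (map_mat Re (hermite_mat_D n z))}"
proof (intro conjI ballI equalityI subsetI)
  fix z assume "z \<in> torus_orbit_space_D n"
  then obtain s where s: "\<forall>k<n. cmod (s k) = 1" and z: "z = orbit_point_D n (torus_point_D n s)"
    using torus_orbit_space_D_eq[of n] assms by auto
  have nz: "\<forall>k<n. s k \<noteq> 0" using s by force
  \<comment> \<open>The roots must be given as real numbers: on the unit circle the inverse is the
    conjugate, so the mean is the real part.\<close>
  have c: "((s k)\<^sup>2 + inverse ((s k)\<^sup>2)) / 2 = of_real (Re ((s k)\<^sup>2))" if "k < n" for k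
  proof -
    have "inverse ((s k)\<^sup>2) = cnj ((s k)\<^sup>2)"
      using s that by (intro cnj_unit[symmetric]) (simp add: norm_power)
    thus ?thesis by (simp only: complex_add_cnj) simp
  qed
  have esym: "esym n i (\<lambda>k. ((s k)\<^sup>2 + inverse ((s k)\<^sup>2)) / 2) = esym n i (\<lambda>k. of_real (Re ((s k)\<^sup>2)))" for i
    unfolding esym_def using c by (intro sum.cong prod.cong) auto
  have "psd_mat (map_mat Re (hermite_mat_D n z))"
  proof (rule psd_hermite_mat_D)
    show "\<forall>i\<in>{1..n}. char_coeff_D n z i = (- 1) ^ i * esym n i (\<lambda>k. of_real (Re ((s k)\<^sup>2)))"
      unfolding z esym[symmetric] using char_coeff_orbit_point_D[OF assms nz] by blast
    show "\<bar>Re ((s k)\<^sup>2)\<bar> \<le> 1" if "k < n" for k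
      using abs_Re_le_cmod[of "(s k)\<^sup>2"] s that by (simp add: norm_power)
  qed
  thus "z \<in> {z \<in> ambient_D n. psd_mat (map_mat Re (hermite_mat_D n z))}"
    using orbit_point_D_in_ambient_D[of n s] assms s by (simp add: z)
qed (use hermite_mat_D_Reals psd_imp_in_orbit_space_D assms in auto)

end
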